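(* Let $n\ge 1$ and let $A,B\in M_n(\mathbb{C})$ be positive semidefinite matrices. Then for every $j\in\{1,2,\dots,n\}$ and every real $t\in(-2,2]$, $$(2+t)\,s_j(AB)\le s_j\left(A^2+tAB+B^2\right).$$
   Context: $M_n(\mathbb{C})$ denotes the $n\times n$ complex matrices. For $X\in M_n(\mathbb{C})$, $s_1(X)\ge s_2(X)\ge\dots\ge s_n(X)$ denote the singular values of $X$ arranged in non-increasing order and counted with multiplicity. *)

theory Defs
  imports
    "Jordan_Normal_Form.Schur_Decomposition"
    "HOL-Library.Multiset"
    "HOL-Computational_Algebra.Fundamental_Theorem_Algebra"
begin

definition psd_mat :: "nat \<Rightarrow> complex mat \<Rightarrow> bool" where
  "psd_mat n A \<longleftrightarrow> A \<in> carrier_mat n n \<and> mat_adjoint A = A \<and>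
     (\<forall>v \<in> carrier_vec n. Re ((A *\<^sub>v v) \<bullet>c v) \<ge> 0)"

(* The singular values of X are the square roots of the eigenvalues of X* X, repeated according
   to multiplicity (as roots of the characteristic polynomial). These eigenvalues are real and
   nonnegative, so Re only serves as the coercion to real. *)
definition singular_values :: "complex mat \<Rightarrow> real list" where
  "singular_values X = rev (sorted_list_of_multiset
     (image_mset (\<lambda>z. sqrt (Re z)) (proots (char_poly (mat_adjoint X * X)))))"

(* Indexed from 1: singular_value X j is s_j(X) for j = 1, ..., n. *)
definition singular_value :: "complex mat \<Rightarrow> nat \<Rightarrow> real" where
  "singular_value X j = singular_values X ! (j - 1)"

lemma length_singular_values:
  assumes "X \<in> carrier_mat n n"
  shows "length (singular_values X) = n"
proof -
  have "mat_adjoint X * X \<in> carrier_mat n n"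
    using assms by (auto simp: mat_adjoint_def)
  then have "degree (char_poly (mat_adjoint X * X)) = n"
    by (simp add: degree_monic_char_poly)
  then have "size (proots (char_poly (mat_adjoint X * X))) = n"
    by (simp add: size_proots_complex)
  then show ?thesis
    unfolding singular_values_def length_rev
    by (metis mset_sorted_list_of_multiset size_image_mset size_mset)
qed

lemma singular_values_decreasing: "sorted_wrt (\<ge>) (singular_values X)"
  unfolding singular_values_def by (simp add: sorted_wrt_rev)

end

theory Submission
  imports Defs "HOL-Analysis.L2_Norm"
begin

text \<open>By the min-max principle, \<open>s\<^sub>j(X) \<ge> c\<close> iff \<open>|X z| \<ge> c |z|\<close> on some \<open>j\<close>-dimensional subspace.
  Since \<open>Re \<langle>(A\<^sup>2 + t A B + B\<^sup>2) z, z\<rangle> \<ge> (2 + t)/4 |(A + B) z|\<^sup>2\<close>, it suffices to find a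
  \<open>j\<close>-dimensional subspace on which \<open>A + B \<ge> 2 s\<close>, where \<open>s\<^sup>2 = s\<^sub>j(A B) > 0\<close> (Drury's theorem).
  By continuity \<open>A\<close> may be assumed invertible. Let \<open>P\<^sup>2 = A\<close> and \<open>D\<^sup>2 = P B P\<close> with \<open>P, D \<ge> 0\<close>. For \<open>g\<close>
  in a \<open>j\<close>-dimensional subspace with \<open>|A B g| \<ge> s\<^sup>2 |g|\<close>, put \<open>y = P B g\<close> and \<open>z = P y + P\<^sup>-\<^sup>1 D y\<close>.
  Then Cauchy-Schwarz and \<open>D + s\<^sup>2 D\<^sup>-\<^sup>1 \<ge> 2 s\<close> give \<open>|z|\<^sup>2 \<ge> 4 s |y|\<^sup>2\<close>. With \<open>a = P z\<close> and
  \<open>b = D P\<^sup>-\<^sup>1 z\<close> one has \<open>|z|\<^sup>2 = Re \<langle>a + b, y\<rangle>\<close> and \<open>\<langle>(A + B) z, z\<rangle> = |a|\<^sup>2 + |b|\<^sup>2 \<ge> |a + b|\<^sup>2 / 2\<close>,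
  and hence \<open>\<langle>(A + B) z, z\<rangle> \<ge> 2 s |z|\<^sup>2\<close>.\<close>

section \<open>Adjoints, inner products and norms\<close>

lemma mat_adjoint_carrier[simp]:
  "A \<in> carrier_mat m n \<Longrightarrow> mat_adjoint A \<in> carrier_mat n m"
  by (auto simp: mat_adjoint_def)

lemma mat_adjoint_dim[simp]:
  "dim_row (mat_adjoint A) = dim_col A" "dim_col (mat_adjoint A) = dim_row A"
  by (auto simp: mat_adjoint_def)

lemma mat_adjoint_mult_vec_carrier[simp]:
  "A \<in> carrier_mat m n \<Longrightarrow> v \<in> carrier_vec m \<Longrightarrow> mat_adjoint A *\<^sub>v v \<in> carrier_vec n"
  by (rule mult_mat_vec_carrier[OF mat_adjoint_carrier])

lemma mat_adjoint_index[simp]: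
  "i < dim_col A \<Longrightarrow> j < dim_row A \<Longrightarrow> mat_adjoint A $$ (i, j) = conjugate (A $$ (j, i))"
  by (auto simp: mat_adjoint_def mat_of_rows_def)

lemma mat_adjoint_adjoint[simp]: "mat_adjoint (mat_adjoint A) = A"
  by (rule eq_matI) auto

lemma mat_adjoint_mult:
  assumes "A \<in> carrier_mat m n" and "B \<in> carrier_mat n k"
  shows "mat_adjoint (A * B) = mat_adjoint B * mat_adjoint (A :: complex mat)"
  using assms by (intro eq_matI) (auto simp: scalar_prod_def intro!: sum.cong)

lemma cscalar_prod_adjoint:
  fixes A :: "complex mat"
  assumes A: "A \<in> carrier_mat m n" and v: "v \<in> carrier_vec n" and w: "w \<in> carrier_vec m"
  shows "(A *\<^sub>v v) \<bullet>c w = v \<bullet>c (mat_adjoint A *\<^sub>v w)"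
proof -
  have "(A *\<^sub>v v) \<bullet>c w = (\<Sum>i<m. \<Sum>k<n. A $$ (i, k) * v $ k * cnj (w $ i))"
    using assms by (auto simp: scalar_prod_def atLeast0LessThan sum_distrib_right intro!: sum.cong)
  also have "\<dots> = (\<Sum>k<n. \<Sum>i<m. A $$ (i, k) * v $ k * cnj (w $ i))"
    by (rule sum.swap)
  also have "\<dots> = v \<bullet>c (mat_adjoint A *\<^sub>v w)"
    using assms
    by (auto simp: scalar_prod_def atLeast0LessThan sum_distrib_left algebra_simps intro!: sum.cong)
  finally show ?thesis .
qed

text \<open>Viewing complex \<open>n\<close>-space as a real inner product space suffices, because every estimate
  below only involves real parts.\<close>

definition rip :: "complex vec \<Rightarrow> complex vec \<Rightarrow> real" where
  "rip v w = Re (v \<bullet>c w)"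

text \<open>Built on \<open>L2_set\<close>, so that Cauchy-Schwarz and the comparison of the norm
  with single entries come from the real case.\<close>

definition vnorm :: "complex vec \<Rightarrow> real" where
  "vnorm v = L2_set (\<lambda>i. cmod (v $ i)) {..<dim_vec v}"

lemma rip_sum:
  "w \<in> carrier_vec n \<Longrightarrow> rip v w = (\<Sum>i<n. Re (v $ i * cnj (w $ i)))"
  by (auto simp: rip_def scalar_prod_def atLeast0LessThan)

lemma rip_add_left:
  assumes "u \<in> carrier_vec n" "v \<in> carrier_vec n" "w \<in> carrier_vec n"
  shows "rip (u + v) w = rip u w + rip v w"
  using assms by (simp add: rip_def add_scalar_prod_distrib[of _ n])

lemma rip_commute:
  assumes "v \<in> carrier_vec n" "w \<in> carrier_vec n"
  shows "rip v w = rip w v"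
  using assms by (simp add: rip_sum[of _ n] algebra_simps)

lemma rip_add_right:
  assumes "u \<in> carrier_vec n" "v \<in> carrier_vec n" "w \<in> carrier_vec n"
  shows "rip w (u + v) = rip w u + rip w v"
  using assms by (simp add: rip_commute[of w n] rip_add_left[of _ n])

lemma rip_smult_left:
  assumes "v \<in> carrier_vec n" "w \<in> carrier_vec n"
  shows "rip (complex_of_real a \<cdot>\<^sub>v v) w = a * rip v w"
  using assms by (simp add: rip_sum[of _ n] sum_distrib_left algebra_simps)

lemma rip_smult_right:
  assumes "v \<in> carrier_vec n" "w \<in> carrier_vec n"
  shows "rip v (complex_of_real a \<cdot>\<^sub>v w) = a * rip v w"
  using assms by (simp add: rip_sum[of _ n] sum_distrib_left algebra_simps)

lemma rip_adjoint:
  assumes "A \<in> carrier_mat m n" "v \<in> carrier_vec n" "w \<in> carrier_vec m"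
  shows "rip (A *\<^sub>v v) w = rip v (mat_adjoint A *\<^sub>v w)"
  using assms by (simp add: rip_def cscalar_prod_adjoint)

lemma rip_hermitian:
  assumes "A \<in> carrier_mat n n" "mat_adjoint A = A" "v \<in> carrier_vec n" "w \<in> carrier_vec n"
  shows "rip (A *\<^sub>v v) w = rip v (A *\<^sub>v w)"
  using rip_adjoint[of A n n v w] assms by simp

lemma vnorm_nonneg[simp]: "0 \<le> vnorm v"
  by (simp add: vnorm_def)

lemma vnorm_sq_sum: "(vnorm v)\<^sup>2 = (\<Sum>i<dim_vec v. (cmod (v $ i))\<^sup>2)"
  by (simp add: vnorm_def L2_set_def sum_nonneg)

lemma rip_self: "rip v v = (vnorm v)\<^sup>2"
  unfolding vnorm_sq_sum rip_sum[OF carrier_vec_dim_vec]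
  by (intro sum.cong) (auto simp: cmod_power2, simp add: power2_eq_square)

lemma vnorm_eq_0_iff:
  assumes "v \<in> carrier_vec n"
  shows "vnorm v = 0 \<longleftrightarrow> v = 0\<^sub>v n"
  using assms by (auto simp: vnorm_def L2_set_eq_0_iff intro!: eq_vecI)

text \<open>Cauchy-Schwarz: the real part of each summand is at most the product of the two moduli,
  and the real inequality for \<open>L2_set\<close> applies to these.\<close>

lemma rip_le_vnorm:
  assumes "v \<in> carrier_vec n" "w \<in> carrier_vec n"
  shows "rip v w \<le> vnorm v * vnorm w"
proof -
  have "rip v w = (\<Sum>i<n. Re (v $ i * cnj (w $ i)))"
    using assms by (simp add: rip_sum[of _ n])
  also have "\<dots> \<le> (\<Sum>i<n. \<bar>cmod (v $ i)\<bar> * \<bar>cmod (w $ i)\<bar>)"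
    by (rule sum_mono) (metis abs_norm_cancel complex_Re_le_cmod complex_mod_cnj norm_mult)
  also have "\<dots> \<le> vnorm v * vnorm w"
    using L2_set_mult_ineq[of "\<lambda>i. cmod (v $ i)" "\<lambda>i. cmod (w $ i)" "{..<n}"] assms
    by (simp add: vnorm_def)
  finally show ?thesis .
qed

lemma vnorm_triangle:
  assumes "v \<in> carrier_vec n" "w \<in> carrier_vec n"
  shows "vnorm (v + w) \<le> vnorm v + vnorm w"
proof (rule power2_le_imp_le)
  have "(vnorm (v + w))\<^sup>2 = (vnorm v)\<^sup>2 + 2 * rip v w + (vnorm w)\<^sup>2"
    using assms rip_commute[OF assms]
    by (simp add: rip_self[symmetric] rip_add_left[of _ n] rip_add_right[of _ n])
  also have "\<dots> \<le> (vnorm v + vnorm w)\<^sup>2"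
    using rip_le_vnorm[OF assms] by (simp add: power2_sum)
  finally show "(vnorm (v + w))\<^sup>2 \<le> (vnorm v + vnorm w)\<^sup>2" .
qed simp

lemma vnorm_smult: "vnorm (complex_of_real a \<cdot>\<^sub>v v) = \<bar>a\<bar> * vnorm v"
  by (rule power2_eq_imp_eq) (simp_all add: vnorm_sq_sum norm_mult power_mult_distrib sum_distrib_left)

text \<open>The sum of all entry moduli is a crude operator bound. Its size is irrelevant: the final
  limit needs only some finite constant for \<open>A\<close> and one for \<open>B\<close>.\<close>

lemma mult_mat_vec_bounded:
  assumes F: "F \<in> carrier_mat m n"
  obtains K where "0 \<le> K" "\<And>v. v \<in> carrier_vec n \<Longrightarrow> vnorm (F *\<^sub>v v) \<le> K * vnorm v"
proof
  let ?K = "\<Sum>i<m. \<Sum>k<n. cmod (F $$ (i, k))"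
  show "0 \<le> ?K" by (intro sum_nonneg) auto
  fix v :: "complex vec" assume v: "v \<in> carrier_vec n"
  have "vnorm (F *\<^sub>v v) \<le> (\<Sum>i<m. cmod ((F *\<^sub>v v) $ i))"
    using F unfolding vnorm_def by (intro order_trans[OF L2_set_le_sum]) auto
  also have "\<dots> \<le> (\<Sum>i<m. \<Sum>k<n. cmod (F $$ (i, k)) * vnorm v)"
  proof (rule sum_mono)
    fix i assume i: "i \<in> {..<m}"
    have "cmod ((F *\<^sub>v v) $ i) = cmod (\<Sum>k<n. F $$ (i, k) * v $ k)"
      using F v i by (auto simp: scalar_prod_def atLeast0LessThan)
    also have "\<dots> \<le> (\<Sum>k<n. cmod (F $$ (i, k)) * vnorm v)"
    proof (rule sum_norm_le)
      fix k assume "k \<in> {..<n}"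
      then have "cmod (v $ k) \<le> vnorm v"
        using v member_le_L2_set[of "{..<n}" k "\<lambda>i. cmod (v $ i)"] by (auto simp: vnorm_def)
      then show "cmod (F $$ (i, k) * v $ k) \<le> cmod (F $$ (i, k)) * vnorm v"
        by (simp add: norm_mult mult_left_mono)
    qed
    finally show "cmod ((F *\<^sub>v v) $ i) \<le> (\<Sum>k<n. cmod (F $$ (i, k)) * vnorm v)" .
  qed
  also have "\<dots> = ?K * vnorm v" by (simp add: sum_distrib_right)
  finally show "vnorm (F *\<^sub>v v) \<le> ?K * vnorm v" .
qed

lemma unitary_adjoint_right:
  fixes W :: "complex mat"
  assumes "W \<in> carrier_mat n n" "mat_adjoint W * W = 1\<^sub>m n"
  shows "W * mat_adjoint W = 1\<^sub>m n"
  using assms mat_mult_left_right_inverse[of "mat_adjoint W" n W] by simp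

lemma vnorm_isometry:
  assumes "W \<in> carrier_mat m n" "mat_adjoint W * W = 1\<^sub>m n" "v \<in> carrier_vec n"
  shows "vnorm (W *\<^sub>v v) = vnorm v"
proof (rule power2_eq_imp_eq)
  show "(vnorm (W *\<^sub>v v))\<^sup>2 = (vnorm v)\<^sup>2"
    using assms rip_adjoint[of W m n v "W *\<^sub>v v"]
    by (simp add: rip_self[symmetric] assoc_mult_mat_vec[symmetric, of _ n m _ n])
qed auto

section \<open>Diagonalisation of Hermitian matrices\<close>

text \<open>Gram-Schmidt produces orthogonal vectors of arbitrary nonzero length. Rescaling makes
  their Gram matrix the identity, since \<open>corthogonal\<close> says that distinct vectors have
  product 0 and that no self-product is 0.\<close>

lemma unitary_of_orthogonal_basis:
  fixes ws :: "complex vec list"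
  assumes ws: "set ws \<subseteq> carrier_vec n" "corthogonal ws" "length ws = n"
  defines "W \<equiv> mat_of_cols n (map (\<lambda>w. complex_of_real (1 / vnorm w) \<cdot>\<^sub>v w) ws)"
  shows "W \<in> carrier_mat n n" and "mat_adjoint W * W = 1\<^sub>m n"
proof -
  show W: "W \<in> carrier_mat n n"
    using ws by (auto simp: W_def mat_of_cols_def)
  have wi: "ws ! i \<in> carrier_vec n" if "i < n" for i
    using ws that by auto
  have entry: "(mat_adjoint W * W) $$ (i, j) =
      complex_of_real (1 / vnorm (ws ! i)) * complex_of_real (1 / vnorm (ws ! j)) * (ws ! j \<bullet>c ws ! i)"
    if ij: "i < n" "j < n" for i j
  proof -
    have "(mat_adjoint W * W) $$ (i, j) = (\<Sum>k<n. cnj (W $$ (k, i)) * W $$ (k, j))"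
      using W ij by (auto simp: scalar_prod_def atLeast0LessThan intro!: sum.cong)
    also have "\<dots> = (\<Sum>k<n. complex_of_real (1 / vnorm (ws ! i)) *
        complex_of_real (1 / vnorm (ws ! j)) * (ws ! j $ k * cnj (ws ! i $ k)))"
      using ws ij wi[OF ij(1)] wi[OF ij(2)]
      by (intro sum.cong) (auto simp: W_def mat_of_cols_def)
    also have "\<dots> = complex_of_real (1 / vnorm (ws ! i)) * complex_of_real (1 / vnorm (ws ! j)) *
        (ws ! j \<bullet>c ws ! i)"
      using wi[OF ij(1)] wi[OF ij(2)]
      by (auto simp: scalar_prod_def atLeast0LessThan sum_distrib_left intro!: sum.cong)
    finally show ?thesis .
  qed
  show "mat_adjoint W * W = 1\<^sub>m n"
  proof (rule eq_matI)
    fix i j assume "i < dim_row (1\<^sub>m n)" "j < dim_col (1\<^sub>m n)"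
    then have ij: "i < n" "j < n" by auto
    show "(mat_adjoint W * W) $$ (i, j) = 1\<^sub>m n $$ (i, j)"
    proof (cases "i = j")
      case False
      then have "ws ! j \<bullet>c ws ! i = 0"
        using corthogonalD[OF ws(2), of j i] ij ws(3) by auto
      then show ?thesis using False ij entry[OF ij] by simp
    next
      case True
      have nz: "ws ! i \<bullet>c ws ! i \<noteq> 0"
        using corthogonalD[OF ws(2), of i i] ij ws(3) by auto
      \<comment> \<open>In the order on complex numbers this includes that the imaginary part is 0,
        so the self-product is a real number.\<close>
      have "0 \<le> ws ! i \<bullet>c ws ! i" by (rule conjugate_square_ge_0_vec)
      then have "ws ! i \<bullet>c ws ! i = complex_of_real (rip (ws ! i) (ws ! i))"
        by (auto simp: rip_def less_eq_complex_def complex_eq_iff)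
      then have sq: "ws ! i \<bullet>c ws ! i = complex_of_real ((vnorm (ws ! i))\<^sup>2)"
        by (simp add: rip_self)
      then have "vnorm (ws ! i) \<noteq> 0" using nz by auto
      then show ?thesis
        using True ij entry[OF ij] sq by (simp add: power2_eq_square)
    qed
  qed (use W in auto)
qed

lemma mat_adjoint_four_block_diag:
  fixes A D :: "complex mat"
  assumes "A \<in> carrier_mat k k" "D \<in> carrier_mat m m"
  shows "mat_adjoint (four_block_mat A (0\<^sub>m k m) (0\<^sub>m m k) D) =
    four_block_mat (mat_adjoint A) (0\<^sub>m k m) (0\<^sub>m m k) (mat_adjoint D)"
  using assms by (intro eq_matI) auto

lemma mult_four_block_diag:
  fixes A D A' D' :: "complex mat"
  assumes "A \<in> carrier_mat k k" "D \<in> carrier_mat m m" "A' \<in> carrier_mat k k" "D' \<in> carrier_mat m m"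
  shows "four_block_mat A (0\<^sub>m k m) (0\<^sub>m m k) D * four_block_mat A' (0\<^sub>m k m) (0\<^sub>m m k) D' =
    four_block_mat (A * A') (0\<^sub>m k m) (0\<^sub>m m k) (D * D')"
  using assms by (subst mult_four_block_mat[of _ k k _ m _ m _ _ k _ m]) auto

text \<open>Deflation: a normalised eigenvector for the first root is completed to a unitary matrix,
  Hermitian symmetry splits off a 1x1 block, and induction handles the remaining block. Any
  enumeration \<open>es\<close> of the roots is allowed, which later permits sorting them.\<close>

theorem hermitian_diagonalization:
  fixes H :: "complex mat"
  assumes "H \<in> carrier_mat n n" "mat_adjoint H = H" "char_poly H = (\<Prod>e\<leftarrow>es. [:- e, 1:])"
  shows "\<exists>W \<in> carrier_mat n n. mat_adjoint W * W = 1\<^sub>m n \<and>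
    H = W * mat_diag n (\<lambda>i. es ! i) * mat_adjoint W"
  using assms
proof (induction es arbitrary: n H)
  case Nil
  then have "n = 0" using degree_monic_char_poly[of H n] by auto
  then show ?case using Nil(1) by (intro bexI[of _ "1\<^sub>m 0"]) auto
next
  case (Cons e es)
  note H = Cons.prems(1) and herm = Cons.prems(2)
  have cp: "char_poly H = [:- e, 1:] * (\<Prod>e\<leftarrow>es. [:- e, 1:])"
    using Cons.prems(3) by simp
  have ev: "eigenvalue H e" unfolding eigenvalue_root_char_poly[OF H] cp by simp
  define v where "v = find_eigenvector H e"
  have "eigenvector H v e" using find_eigenvector[OF H ev] by (simp add: v_def)
  then have v: "v \<in> carrier_vec n" and v0: "v \<noteq> 0\<^sub>v n" and Hv: "H *\<^sub>v v = e \<cdot>\<^sub>v v"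
    using H by (auto simp: eigenvector_def)
  have "n \<noteq> 0" using v v0 by (auto intro!: eq_vecI)
  then obtain m where n: "n = Suc m" by (cases n) auto
  interpret cof_vec_space n "TYPE(complex)" .
  define b where "b = basis_completion v"
  define ws where "ws = gram_schmidt n b"
  note bc = basis_completion[OF v v0, folded b_def]
  have b_eq: "b = v # tl b" using bc(6,7) n by (cases b) auto
  have ws: "set ws \<subseteq> carrier_vec n" "corthogonal ws" "length ws = n"
    using gram_schmidt_result[OF bc(2,4,5) refl, folded ws_def] bc(6) by auto
  \<comment> \<open>Gram-Schmidt keeps the head of its input, so the first column of
    \<open>W\<close> will be a multiple of the eigenvector.\<close>
  have ws0: "ws ! 0 = v"
    using gram_schmidt_hd[OF v, of "tl b"] b_eq ws(3) n unfolding ws_def[symmetric]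
    by (metis hd_conv_nth length_0_conv nat.distinct(1) ws_def)
  define W where "W = mat_of_cols n (map (\<lambda>w. complex_of_real (1 / vnorm w) \<cdot>\<^sub>v w) ws)"
  note W = unitary_of_orthogonal_basis(1)[OF ws, folded W_def]
    and WW = unitary_of_orthogonal_basis(2)[OF ws, folded W_def]
  note WW' = unitary_adjoint_right[OF W WW]
  have col0: "H *\<^sub>v col W 0 = e \<cdot>\<^sub>v col W 0"
  proof -
    have "col W 0 = complex_of_real (1 / vnorm v) \<cdot>\<^sub>v v"
      using ws ws0 n v by (simp add: W_def)
    then show ?thesis
      using H v Hv by (simp add: mult_mat_vec[OF H v] smult_smult_assoc mult.commute)
  qed
  define H' where "H' = mat_adjoint W * H * W"
  have H': "H' \<in> carrier_mat n n" using W H by (auto simp: H'_def)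
  have H'_herm: "mat_adjoint H' = H'"
  proof -
    have "mat_adjoint H' = mat_adjoint W * (mat_adjoint H * mat_adjoint (mat_adjoint W))"
      unfolding H'_def using W H mat_adjoint_mult[of "mat_adjoint W * H" n n W n]
        mat_adjoint_mult[of "mat_adjoint W" n n H n] mult_carrier_mat[of "mat_adjoint W" n n H n]
      by simp
    then show ?thesis using herm W H by (simp add: H'_def assoc_mult_mat[of _ n n _ n _ n]
          mult_carrier_mat[of _ n n _ n])
  qed
  \<comment> \<open>Column 0 of \<open>H'\<close> is the adjoint of \<open>W\<close> applied to
    \<open>e\<close> times column 0 of \<open>W\<close>, that is, \<open>e\<close> times the first
    unit vector.\<close>
  have H'0: "H' $$ (i, 0) = (if i = 0 then e else 0)" if i: "i < n" for i
  proof -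
    have "col (H * W) 0 = e \<cdot>\<^sub>v col W 0"
      using col0 W H n by (metis col_mult2 zero_less_Suc)
    then have "H' $$ (i, 0) = row (mat_adjoint W) i \<bullet> (e \<cdot>\<^sub>v col W 0)"
      using W H i n by (simp add: H'_def assoc_mult_mat[of _ n n _ n _ n]
          mult_carrier_mat[of _ n n _ n])
    also have "\<dots> = e * (mat_adjoint W * W) $$ (i, 0)"
      using W i n by simp
    finally show ?thesis using i n by (simp add: WW)
  qed
  have H'0': "H' $$ (0, i) = (if i = 0 then e else 0)" if i: "i < n" for i
  proof (cases "i = 0")
    case True then show ?thesis using H'0 i by simp
  next
    case False
    have "H' $$ (0, i) = mat_adjoint H' $$ (0, i)" by (simp add: H'_herm)
    also have "\<dots> = cnj (H' $$ (i, 0))" using H' i n by (subst mat_adjoint_index) auto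
    finally show ?thesis using H'0[OF i] False by simp
  qed
  define H3 where "H3 = mat m m (\<lambda>(i, j). H' $$ (Suc i, Suc j))"
  have H3: "H3 \<in> carrier_mat m m" by (simp add: H3_def)
  define E where "E = mat 1 1 (\<lambda>_. e)"
  have E: "E \<in> carrier_mat 1 1" by (simp add: E_def)
  have blk: "H' = four_block_mat E (0\<^sub>m 1 m) (0\<^sub>m m 1) H3"
    using H' n H'0 H'0' by (intro eq_matI) (auto simp: H3_def E_def)
  have H3_herm: "mat_adjoint H3 = H3"
  proof (rule eq_matI)
    fix i j assume "i < dim_row H3" "j < dim_col H3"
    then have ij: "i < m" "j < m" using H3 by auto
    have "H' $$ (Suc i, Suc j) = mat_adjoint H' $$ (Suc i, Suc j)" by (simp add: H'_herm)
    also have "\<dots> = cnj (H' $$ (Suc j, Suc i))" using H' ij n by (subst mat_adjoint_index) auto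
    finally show "mat_adjoint H3 $$ (i, j) = H3 $$ (i, j)"
      using ij by (simp add: H3_def)
  qed (use H3 in auto)
  have H_eq: "H = W * H' * mat_adjoint W"
  proof -
    have "W * H' * mat_adjoint W = (W * mat_adjoint W) * H * (W * mat_adjoint W)"
      using W H by (simp add: H'_def assoc_mult_mat[of _ n n _ n _ n]
          mult_carrier_mat[of _ n n _ n])
    then show ?thesis using H by (simp add: WW')
  qed
  have "similar_mat_wit H H' W (mat_adjoint W)"
    using H H' W WW WW' H_eq by (intro similar_mat_witI[of _ _ n]) auto
  then have "char_poly H = char_poly H'"
    by (intro char_poly_similar) (auto simp: similar_mat_def)
  also have "\<dots> = char_poly E * char_poly H3"
    unfolding blk by (rule char_poly_four_block_zeros_col[OF E _ H3]) auto
  also have "char_poly E = [:- e, 1:]"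
    by (simp add: E_def char_poly_defs det_def sign_def)
  \<comment> \<open>Similarity and the block form make \<open>char_poly H\<close> the linear factor
    of \<open>e\<close> times \<open>char_poly H3\<close>; cancelling that factor leaves the roots
    \<open>es\<close>.\<close>
  finally have "char_poly H3 = (\<Prod>e\<leftarrow>es. [:- e, 1:])"
    using cp by (metis mult_cancel_left pCons_eq_0_iff zero_neq_one)
  from Cons.IH[OF H3 H3_herm this] obtain U where U: "U \<in> carrier_mat m m"
    and UU: "mat_adjoint U * U = 1\<^sub>m m"
    and H3_eq: "H3 = U * mat_diag m (\<lambda>i. es ! i) * mat_adjoint U" by blast
  \<comment> \<open>\<open>F\<close> extends by 1 the unitary \<open>U\<close> that diagonalises
    \<open>H3\<close>. It diagonalises \<open>H'\<close>, so \<open>W * F\<close> diagonalises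
    \<open>H\<close>.\<close>
  define F where "F = four_block_mat (1\<^sub>m 1) (0\<^sub>m 1 m) (0\<^sub>m m 1) U"
  have F: "F \<in> carrier_mat n n" using U n unfolding F_def
    by (metis four_block_carrier_mat one_carrier_mat plus_1_eq_Suc)
  have adj1: "mat_adjoint (1\<^sub>m 1 :: complex mat) = 1\<^sub>m 1"
    by (rule eq_matI) auto
  have F_adj: "mat_adjoint F = four_block_mat (1\<^sub>m 1) (0\<^sub>m 1 m) (0\<^sub>m m 1) (mat_adjoint U)"
    unfolding F_def using U by (subst mat_adjoint_four_block_diag) (auto simp: adj1)
  have FF: "mat_adjoint F * F = 1\<^sub>m n"
    unfolding F_adj unfolding F_def using U UU n
    by (subst mult_four_block_diag) (auto intro!: eq_matI)
  have diag: "mat_diag n (\<lambda>i. (e # es) ! i) =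
      four_block_mat E (0\<^sub>m 1 m) (0\<^sub>m m 1) (mat_diag m (\<lambda>i. es ! i))"
    unfolding n by (intro eq_matI) (auto simp: mat_diag_def E_def nth_Cons split: nat.splits)
  have H'_eq: "H' = F * mat_diag n (\<lambda>i. (e # es) ! i) * mat_adjoint F"
    unfolding diag F_adj blk unfolding F_def using U E
    by (simp add: mult_four_block_diag H3_eq)
  show ?case
  proof (intro bexI conjI)
    show WF: "W * F \<in> carrier_mat n n" using W F by auto
    have WF_adj: "mat_adjoint (W * F) = mat_adjoint F * mat_adjoint W"
      using W F by (rule mat_adjoint_mult)
    have "mat_adjoint (W * F) * (W * F) = mat_adjoint F * (mat_adjoint W * W) * F"
      unfolding WF_adj using W F by (simp add: assoc_mult_mat[of _ n n _ n _ n] mult_carrier_mat[of _ n n _ n])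
    then show "mat_adjoint (W * F) * (W * F) = 1\<^sub>m n"
      using F FF by (simp add: WW)
    show "H = W * F * mat_diag n (\<lambda>i. (e # es) ! i) * mat_adjoint (W * F)"
      unfolding WF_adj H_eq H'_eq using W F
      by (simp add: assoc_mult_mat[of _ n n _ n _ n] mult_carrier_mat[of _ n n _ n])
  qed
qed

section \<open>Spectral form and square roots of positive semidefinite matrices\<close>

lemma rip_unitary_diag:
  assumes W: "W \<in> carrier_mat n n" and v: "v \<in> carrier_vec n"
  shows "rip ((W * mat_diag n d * mat_adjoint W) *\<^sub>v v) v =
    (\<Sum>i<n. Re (d i) * (cmod ((mat_adjoint W *\<^sub>v v) $ i))\<^sup>2)"
proof -
  define u where "u = mat_adjoint W *\<^sub>v v"
  have u: "u \<in> carrier_vec n" using W v by (simp add: u_def)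
  have Du: "mat_diag n d *\<^sub>v u = vec n (\<lambda>i. d i * u $ i)"
  proof (rule eq_vecI)
    fix i assume "i < dim_vec (vec n (\<lambda>i. d i * u $ i))"
    then have i: "i < n" by simp
    have "(mat_diag n d *\<^sub>v u) $ i = (\<Sum>k<n. (if i = k then d k else 0) * u $ k)"
      using i u by (auto simp: mat_diag_def scalar_prod_def atLeast0LessThan)
    also have "\<dots> = (\<Sum>k<n. if k = i then d i * u $ i else 0)"
      by (intro sum.cong) auto
    also have "\<dots> = d i * u $ i" using i by simp
    finally show "(mat_diag n d *\<^sub>v u) $ i = vec n (\<lambda>i. d i * u $ i) $ i" using i by simp
  qed (simp add: mat_diag_def)
  have "(W * mat_diag n d * mat_adjoint W) *\<^sub>v v = W *\<^sub>v (mat_diag n d *\<^sub>v u)"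
    using W v by (simp add: u_def assoc_mult_mat_vec[of _ n n _ n] mult_carrier_mat[of _ n n _ n])
  then have "rip ((W * mat_diag n d * mat_adjoint W) *\<^sub>v v) v = rip (mat_diag n d *\<^sub>v u) u"
    using W v u rip_adjoint[of W n n "mat_diag n d *\<^sub>v u" v]
    by (simp add: u_def[symmetric] mult_mat_vec_carrier[OF mat_diag_dim])
  also have "\<dots> = (\<Sum>i<n. Re (d i) * (cmod (u $ i))\<^sup>2)"
    unfolding Du rip_sum[OF u]
  proof (intro sum.cong refl)
    fix i assume "i \<in> {..<n}"
    then have "vec n (\<lambda>i. d i * u $ i) $ i * cnj (u $ i) = d i * (u $ i * cnj (u $ i))" by simp
    also have "\<dots> = d i * complex_of_real ((cmod (u $ i))\<^sup>2)"
      by (simp only: complex_norm_square)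
    finally show "Re (vec n (\<lambda>i. d i * u $ i) $ i * cnj (u $ i)) = Re (d i) * (cmod (u $ i))\<^sup>2"
      by simp
  qed
  finally show ?thesis by (simp add: u_def)
qed

text \<open>The diagonal factor equals the Hermitian matrix \<open>mat_adjoint W * H * W\<close>, so
  its entries are real. They are nonnegative because entry i is the value of the quadratic form of
  \<open>H\<close> at column i of \<open>W\<close>. The order of \<open>es\<close> remains
  free.\<close>

lemma psd_diagonalization:
  assumes psd: "psd_mat n H" and es: "mset es = proots (char_poly H)"
  obtains W where "W \<in> carrier_mat n n" "mat_adjoint W * W = 1\<^sub>m n"
    "H = W * mat_diag n (\<lambda>i. complex_of_real (Re (es ! i))) * mat_adjoint W"
    "\<And>i. i < n \<Longrightarrow> 0 \<le> Re (es ! i)"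
proof -
  have H: "H \<in> carrier_mat n n" and herm: "mat_adjoint H = H"
    and pos: "\<And>v. v \<in> carrier_vec n \<Longrightarrow> 0 \<le> rip (H *\<^sub>v v) v"
    using psd by (auto simp: psd_mat_def rip_def)
  have "char_poly H = (\<Prod>x\<in>#proots (char_poly H). [:- x, 1:])"
    using complex_poly_decompose_multiset[of "char_poly H"] degree_monic_char_poly[OF H] by simp
  also have "\<dots> = (\<Prod>e\<leftarrow>es. [:- e, 1:])"
    by (simp add: es[symmetric] prod_mset_prod_list[symmetric])
  finally have "char_poly H = (\<Prod>e\<leftarrow>es. [:- e, 1:])" .
  from hermitian_diagonalization[OF H herm this] obtain W where W: "W \<in> carrier_mat n n"
    and WW: "mat_adjoint W * W = 1\<^sub>m n"
    and H_eq: "H = W * mat_diag n (\<lambda>i. es ! i) * mat_adjoint W" by blast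
  let ?D = "mat_diag n (\<lambda>i. es ! i)"
  have "mat_adjoint W * H * W = (mat_adjoint W * W) * ?D * (mat_adjoint W * W)"
    unfolding H_eq using W by (simp add: assoc_mult_mat[of _ n n _ n _ n] mult_carrier_mat[of _ n n _ n])
  then have D_eq: "mat_adjoint W * H * W = ?D"
    by (simp add: WW left_mult_one_mat[OF mat_diag_dim] right_mult_one_mat[OF mat_diag_dim])
  have "mat_adjoint ?D = ?D"
    unfolding D_eq[symmetric] using W H herm
      mat_adjoint_mult[of "mat_adjoint W * H" n n W n] mult_carrier_mat[of "mat_adjoint W" n n H n]
      mat_adjoint_mult[of "mat_adjoint W" n n H n]
    by (simp add: assoc_mult_mat[of _ n n _ n _ n] mult_carrier_mat[of _ n n _ n])
  then have "cnj (es ! i) = es ! i" if "i < n" for i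
    using that mat_adjoint_index[of i ?D i] by (simp add: mat_diag_def)
  then have real: "es ! i = complex_of_real (Re (es ! i))" if "i < n" for i
    using that by (auto simp: complex_eq_iff)
  show thesis
  proof
    show "W \<in> carrier_mat n n" "mat_adjoint W * W = 1\<^sub>m n" by fact+
    have "?D = mat_diag n (\<lambda>i. complex_of_real (Re (es ! i)))"
      using real by (auto simp: mat_diag_def intro!: eq_matI)
    then show "H = W * mat_diag n (\<lambda>i. complex_of_real (Re (es ! i))) * mat_adjoint W"
      using H_eq by simp
    fix i assume i: "i < n"
    define w where "w = W *\<^sub>v unit_vec n i"
    have w: "w \<in> carrier_vec n" using W by (simp add: w_def)
    have "mat_adjoint W *\<^sub>v w = unit_vec n i"
      using W by (simp add: w_def assoc_mult_mat_vec[symmetric, of _ n n _ n] WW)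
    then have "rip (H *\<^sub>v w) w = (\<Sum>k<n. Re (es ! k) * (cmod (unit_vec n i $ k))\<^sup>2)"
      using rip_unitary_diag[OF W w, of "\<lambda>i. es ! i"] by (simp add: H_eq[symmetric])
    also have "\<dots> = (\<Sum>k<n. if k = i then Re (es ! i) else 0)"
      using i by (intro sum.cong) auto
    also have "\<dots> = Re (es ! i)" using i by simp
    finally show "0 \<le> Re (es ! i)" using pos[OF w] by simp
  qed
qed

text \<open>Take square roots of the eigenvalues in the same orthonormal eigenbasis.\<close>

lemma psd_sqrt:
  assumes psd: "psd_mat n H"
  obtains P where "psd_mat n P" "P * P = H"
proof -
  obtain es where es: "mset es = proots (char_poly H)" using ex_mset by blast
  obtain W where W: "W \<in> carrier_mat n n" and WW: "mat_adjoint W * W = 1\<^sub>m n"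
    and H_eq: "H = W * mat_diag n (\<lambda>i. complex_of_real (Re (es ! i))) * mat_adjoint W"
    and nn: "\<And>i. i < n \<Longrightarrow> 0 \<le> Re (es ! i)"
    by (rule psd_diagonalization[OF psd es], rule that)
  let ?E = "mat_diag n (\<lambda>i. complex_of_real (sqrt (Re (es ! i))))"
  let ?P = "W * ?E * mat_adjoint W"
  have E_adj: "mat_adjoint ?E = ?E"
    by (rule eq_matI) (auto simp: mat_diag_def)
  have EE: "?E * ?E = mat_diag n (\<lambda>i. complex_of_real (Re (es ! i)))"
    unfolding mat_diag_diag using nn
    by (intro eq_matI) (auto simp: mat_diag_def simp flip: of_real_mult)
  show thesis
  proof
    have "?P * ?P = W * ?E * (mat_adjoint W * W) * ?E * mat_adjoint W"
      using W by (simp add: assoc_mult_mat[of _ n n _ n _ n] mult_carrier_mat[of _ n n _ n])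
    also have "\<dots> = W * (?E * ?E) * mat_adjoint W"
      using W by (simp add: WW assoc_mult_mat[of _ n n _ n _ n] mult_carrier_mat[of _ n n _ n]
          left_mult_one_mat[of _ n n] del: mat_diag_diag)
    finally show "?P * ?P = H" by (simp only: EE H_eq[symmetric])
    have "mat_adjoint ?P = ?P"
      using W mat_adjoint_mult[of "W * ?E" n n "mat_adjoint W" n]
        mult_carrier_mat[of W n n ?E n] mat_adjoint_mult[of W n n ?E n]
      by (simp add: E_adj assoc_mult_mat[of _ n n _ n _ n] mult_carrier_mat[of _ n n _ n])
    moreover have "0 \<le> rip (?P *\<^sub>v v) v" if "v \<in> carrier_vec n" for v
      unfolding rip_unitary_diag[OF W that] using nn by (intro sum_nonneg) auto
    ultimately show "psd_mat n ?P"
      using W by (auto simp: psd_mat_def rip_def)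
  qed
qed

section \<open>Variational description of singular values\<close>

text \<open>The columns of \<open>W\<close> are right singular vectors: the squared norm of
  \<open>X v\<close> is the quadratic form of \<open>mat_adjoint X * X\<close>, and \<open>W\<close>
  diagonalises that matrix with coordinate i matched to entry i of
  \<open>singular_values X\<close>.\<close>

lemma singular_value_decomposition:
  assumes X: "X \<in> carrier_mat n n"
  obtains W where "W \<in> carrier_mat n n" "mat_adjoint W * W = 1\<^sub>m n"
    "\<And>v. v \<in> carrier_vec n \<Longrightarrow> (vnorm (X *\<^sub>v v))\<^sup>2 =
      (\<Sum>i<n. (singular_values X ! i)\<^sup>2 * (cmod ((mat_adjoint W *\<^sub>v v) $ i))\<^sup>2)"
    "\<And>i. i < n \<Longrightarrow> 0 \<le> singular_values X ! i"
proof -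
  let ?H = "mat_adjoint X * X"
  let ?g = "\<lambda>z. sqrt (Re z)"
  have H: "?H \<in> carrier_mat n n" using X by auto
  have quad: "rip (?H *\<^sub>v v) v = (vnorm (X *\<^sub>v v))\<^sup>2" if v: "v \<in> carrier_vec n" for v
    using X v rip_adjoint[of "mat_adjoint X" n n "X *\<^sub>v v" v]
    by (simp add: rip_self assoc_mult_mat_vec[of _ n n _ n] mult_carrier_mat[of _ n n _ n])
  have psd: "psd_mat n ?H"
    unfolding psd_mat_def using X H quad mat_adjoint_mult[of "mat_adjoint X" n n X n]
    by (auto simp: rip_def)
  obtain es0 where es0: "mset es0 = proots (char_poly ?H)" using ex_mset by blast
  \<comment> \<open>Sorting the complex eigenvalues by their square roots and reversing makes
    \<open>map ?g es\<close> the list \<open>singular_values X\<close> itself.\<close>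
  define es where "es = rev (sort_key ?g es0)"
  have es: "mset es = proots (char_poly ?H)" by (simp add: es_def es0)
  have "size (proots (char_poly ?H)) = n"
    using degree_monic_char_poly[OF H] by (simp add: size_proots_complex)
  then have len: "length es = n" using es by (metis size_mset)
  have "image_mset ?g (proots (char_poly ?H)) = mset (map ?g (sort_key ?g es0))"
    by (simp add: es0)
  then have "sorted_list_of_multiset (image_mset ?g (proots (char_poly ?H))) =
      sort (map ?g (sort_key ?g es0))"
    by (metis sorted_list_of_multiset_mset)
  also have "\<dots> = map ?g (sort_key ?g es0)"
    by (rule sorted_sort_id) simp
  finally have sv: "singular_values X = map ?g es"
    by (simp add: singular_values_def es_def rev_map)
  obtain W where W: "W \<in> carrier_mat n n" "mat_adjoint W * W = 1\<^sub>m n"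
    and H_eq: "?H = W * mat_diag n (\<lambda>i. complex_of_real (Re (es ! i))) * mat_adjoint W"
    and nn: "\<And>i. i < n \<Longrightarrow> 0 \<le> Re (es ! i)"
    by (rule psd_diagonalization[OF psd es], rule that)
  show thesis
  proof
    show "W \<in> carrier_mat n n" "mat_adjoint W * W = 1\<^sub>m n" by fact+
    show "0 \<le> singular_values X ! i" if "i < n" for i
      using that nn len by (simp add: sv)
    fix v :: "complex vec" assume v: "v \<in> carrier_vec n"
    show "(vnorm (X *\<^sub>v v))\<^sup>2 =
        (\<Sum>i<n. (singular_values X ! i)\<^sup>2 * (cmod ((mat_adjoint W *\<^sub>v v) $ i))\<^sup>2)"
      unfolding quad[OF v, symmetric] H_eq rip_unitary_diag[OF W(1) v]
      using nn len by (intro sum.cong) (auto simp: sv)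
  qed
qed

lemma singular_value_nonneg:
  assumes "X \<in> carrier_mat n n" "j \<in> {1..n}"
  shows "0 \<le> singular_value X j"
proof -
  have "j - 1 < n" using assms by auto
  then show ?thesis
    unfolding singular_value_def using singular_value_decomposition[OF assms(1)] by metis
qed

lemma singular_values_antimono:
  assumes X: "X \<in> carrier_mat n n" and "i \<le> k" "k < n"
  shows "singular_values X ! k \<le> singular_values X ! i"
  using sorted_wrt_nth_less[OF singular_values_decreasing, of i k X] assms
    length_singular_values[OF X] by (cases "i = k") auto

text \<open>A j-dimensional subspace is encoded as the range of an n x j matrix; that nonzero
  vectors have nonzero images is injectivity, which makes the dimension exactly j.\<close>

definition expands_subspace :: "nat \<Rightarrow> nat \<Rightarrow> complex mat \<Rightarrow> real \<Rightarrow> bool" where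
  "expands_subspace n j X c \<longleftrightarrow> (\<exists>V \<in> carrier_mat n j. \<forall>x \<in> carrier_vec j. x \<noteq> 0\<^sub>v j \<longrightarrow>
     V *\<^sub>v x \<noteq> 0\<^sub>v n \<and> c * vnorm (V *\<^sub>v x) \<le> vnorm (X *\<^sub>v (V *\<^sub>v x)))"

text \<open>One half of the min-max principle: the span of the first j right singular vectors works,
  since only singular values that are at least the j-th enter there.\<close>

lemma expands_subspace_singular_value:
  assumes X: "X \<in> carrier_mat n n" and j: "j \<in> {1..n}"
  shows "expands_subspace n j X (singular_value X j)"
proof -
  obtain W where W: "W \<in> carrier_mat n n" and WW: "mat_adjoint W * W = 1\<^sub>m n"
    and XW: "\<And>v. v \<in> carrier_vec n \<Longrightarrow> (vnorm (X *\<^sub>v v))\<^sup>2 =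
      (\<Sum>i<n. (singular_values X ! i)\<^sup>2 * (cmod ((mat_adjoint W *\<^sub>v v) $ i))\<^sup>2)"
    by (rule singular_value_decomposition[OF X], rule that)
  \<comment> \<open>\<open>J\<close> embeds the first j coordinates, so the columns of
    \<open>W * J\<close> are the first j columns of \<open>W\<close>.\<close>
  define J where "J = mat n j (\<lambda>(i, k). if i = k then 1 else (0 :: complex))"
  have J: "J \<in> carrier_mat n j" by (simp add: J_def)
  have Jx: "(J *\<^sub>v x) $ i = (if i < j then x $ i else 0)" if "i < n" "x \<in> carrier_vec j" for i x
  proof -
    have "(J *\<^sub>v x) $ i = (\<Sum>k<j. (if i = k then 1 else 0) * x $ k)"
      using that by (auto simp: J_def scalar_prod_def atLeast0LessThan)
    also have "\<dots> = (\<Sum>k<j. if k = i then x $ i else 0)"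
      by (intro sum.cong) auto
    finally show ?thesis by simp
  qed
  show ?thesis
    unfolding expands_subspace_def
  proof (intro bexI ballI impI)
    show WJ: "W * J \<in> carrier_mat n j" using W J by simp
    fix x :: "complex vec" assume x: "x \<in> carrier_vec j" and x0: "x \<noteq> 0\<^sub>v j"
    let ?v = "(W * J) *\<^sub>v x"
    have v: "?v \<in> carrier_vec n" using WJ x by simp
    have Jxc: "J *\<^sub>v x \<in> carrier_vec n" using J x by simp
    have v_eq: "?v = W *\<^sub>v (J *\<^sub>v x)" using W J x by simp
    have Wv: "mat_adjoint W *\<^sub>v ?v = J *\<^sub>v x"
      using W Jxc by (simp add: v_eq assoc_mult_mat_vec[symmetric, of _ n n _ n] WW)
    have norm_v: "vnorm ?v = vnorm (J *\<^sub>v x)"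
      unfolding v_eq using W WW Jxc by (rule vnorm_isometry)
    have "J *\<^sub>v x \<noteq> 0\<^sub>v n"
    proof
      assume 0: "J *\<^sub>v x = 0\<^sub>v n"
      have "x $ i = 0" if "i < j" for i
        using Jx[of i x] that x j by (simp add: 0)
      then show False using x x0 by (auto intro!: eq_vecI)
    qed
    then have v0: "?v \<noteq> 0\<^sub>v n"
      using norm_v vnorm_eq_0_iff[OF v] vnorm_eq_0_iff[OF Jxc] by simp
    have "(singular_value X j * vnorm ?v)\<^sup>2 =
        (\<Sum>i<n. (singular_value X j)\<^sup>2 * (cmod ((J *\<^sub>v x) $ i))\<^sup>2)"
      using J by (simp add: norm_v power_mult_distrib vnorm_sq_sum sum_distrib_left)
    also have "\<dots> \<le> (\<Sum>i<n. (singular_values X ! i)\<^sup>2 * (cmod ((J *\<^sub>v x) $ i))\<^sup>2)"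
    proof (rule sum_mono)
      fix i assume i: "i \<in> {..<n}"
      show "(singular_value X j)\<^sup>2 * (cmod ((J *\<^sub>v x) $ i))\<^sup>2
        \<le> (singular_values X ! i)\<^sup>2 * (cmod ((J *\<^sub>v x) $ i))\<^sup>2"
      \<comment> \<open>Positions count from 0, so the j-th singular value sits at position j - 1.
        Entries at i < j are at least that large, and for other i the coordinate of
        \<open>J *\<^sub>v x\<close> is 0.\<close>
      proof (cases "i < j")
        case True
        then have "singular_value X j \<le> singular_values X ! i"
          using singular_values_antimono[OF X, of i "j - 1"] j by (auto simp: singular_value_def)
        then show ?thesis
          using singular_value_nonneg[OF X j] by (intro mult_right_mono power_mono) auto
      next
        case False
        then show ?thesis using Jx[of i x] i x by simp
      qed
    qed
    also have "\<dots> = (vnorm (X *\<^sub>v ?v))\<^sup>2" using XW[OF v] by (simp only: Wv)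
    finally show "?v \<noteq> 0\<^sub>v n \<and> singular_value X j * vnorm ?v \<le> vnorm (X *\<^sub>v ?v)"
      using v0 by (auto intro: power2_le_imp_le)
  qed
qed

text \<open>The other half of the min-max principle: by a dimension count, the range of
  \<open>V\<close> meets the span of the singular vectors from position j - 1 on, where
  \<open>X\<close> stretches by at most the j-th singular value.\<close>

lemma expands_subspace_le_singular_value:
  assumes X: "X \<in> carrier_mat n n" and j: "j \<in> {1..n}" and ex: "expands_subspace n j X c"
  shows "c \<le> singular_value X j"
proof (rule ccontr)
  assume "\<not> c \<le> singular_value X j"
  then have less: "singular_value X j < c" by simp
  obtain W where W: "W \<in> carrier_mat n n" and WW: "mat_adjoint W * W = 1\<^sub>m n"
    and XW: "\<And>v. v \<in> carrier_vec n \<Longrightarrow> (vnorm (X *\<^sub>v v))\<^sup>2 =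
      (\<Sum>i<n. (singular_values X ! i)\<^sup>2 * (cmod ((mat_adjoint W *\<^sub>v v) $ i))\<^sup>2)"
    and nn: "\<And>i. i < n \<Longrightarrow> 0 \<le> singular_values X ! i"
    by (rule singular_value_decomposition[OF X], rule that)
  obtain V where V: "V \<in> carrier_mat n j" and exV: "\<And>x. x \<in> carrier_vec j \<Longrightarrow> x \<noteq> 0\<^sub>v j \<Longrightarrow>
     V *\<^sub>v x \<noteq> 0\<^sub>v n \<and> c * vnorm (V *\<^sub>v x) \<le> vnorm (X *\<^sub>v (V *\<^sub>v x))"
    using ex by (auto simp: expands_subspace_def)
  \<comment> \<open>Some nonzero vector in the \<open>j\<close>-dimensional range of \<open>V\<close> is orthogonal to the
    first \<open>j - 1\<close> columns of \<open>W\<close>; padding with a zero row makes the system square.\<close>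
  define U where "U = mat_adjoint W * V"
  have U: "U \<in> carrier_mat n j" using W V by (auto simp: U_def)
  define M where "M = mat j j (\<lambda>(i, k). if i = j - 1 then 0 else U $$ (i, k))"
  have M: "M \<in> carrier_mat j j" by (simp add: M_def)
  \<comment> \<open>Row j - 1 of \<open>M\<close> is zero, so the transpose of \<open>M\<close>
    annihilates this nonzero unit vector and \<open>det M\<close> is 0.\<close>
  have "unit_vec j (j - 1) \<noteq> (0\<^sub>v j :: complex vec)"
  proof
    assume "unit_vec j (j - 1) = (0\<^sub>v j :: complex vec)"
    then have "unit_vec j (j - 1) $ (j - 1) = (0\<^sub>v j :: complex vec) $ (j - 1)" by simp
    then show False using j by simp
  qed
  moreover have "transpose_mat M *\<^sub>v unit_vec j (j - 1) = 0\<^sub>v j"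
    using j M by (intro eq_vecI) (auto simp: M_def)
  moreover have "transpose_mat M \<in> carrier_mat j j" using M by simp
  ultimately have "det (transpose_mat M) = 0"
    using det_0_iff_vec_prod_zero_field unit_vec_carrier by blast
  then have "det M = 0" using det_transpose[OF M] by simp
  then obtain x where x: "x \<in> carrier_vec j" and x0: "x \<noteq> 0\<^sub>v j" and Mx: "M *\<^sub>v x = 0\<^sub>v j"
    using det_0_iff_vec_prod_zero_field[OF M] by blast
  define v where "v = V *\<^sub>v x"
  have v: "v \<in> carrier_vec n" using V x by (simp add: v_def)
  define u where "u = mat_adjoint W *\<^sub>v v"
  have u: "u \<in> carrier_vec n" using W v by (simp add: u_def)
  have u_eq: "u = U *\<^sub>v x" 
    by (simp add: u_def v_def U_def assoc_mult_mat_vec[OF mat_adjoint_carrier[OF W] V x])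
  have u0: "u $ i = 0" if i: "i < j - 1" for i
  proof -
    have "row M i = row U i"
      using i j U by (intro eq_vecI) (auto simp: M_def)
    moreover have "i < n" "i < j" using i j by auto
    ultimately have "u $ i = (M *\<^sub>v x) $ i" using U M by (simp add: u_eq)
    then show ?thesis using i by (simp add: Mx)
  qed
  have norm_u: "vnorm u = vnorm v"
    unfolding u_def using W v unitary_adjoint_right[OF W WW]
    by (intro vnorm_isometry) auto
  have "(vnorm (X *\<^sub>v v))\<^sup>2 = (\<Sum>i<n. (singular_values X ! i)\<^sup>2 * (cmod (u $ i))\<^sup>2)"
    using XW[OF v] by (simp only: u_def)
  also have "\<dots> \<le> (\<Sum>i<n. (singular_value X j)\<^sup>2 * (cmod (u $ i))\<^sup>2)"
  proof (rule sum_mono)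
    fix i assume i: "i \<in> {..<n}"
    show "(singular_values X ! i)\<^sup>2 * (cmod (u $ i))\<^sup>2 \<le> (singular_value X j)\<^sup>2 * (cmod (u $ i))\<^sup>2"
    proof (cases "i < j - 1")
      case True
      then show ?thesis by (simp add: u0)
    next
      case False
      then have "singular_values X ! i \<le> singular_value X j"
        using singular_values_antimono[OF X, of "j - 1" i] i by (auto simp: singular_value_def)
      then show ?thesis using nn[of i] i by (intro mult_right_mono power_mono) auto
    qed
  qed
  also have "\<dots> = (singular_value X j * vnorm v)\<^sup>2"
    using u by (simp add: norm_u[symmetric] power_mult_distrib vnorm_sq_sum sum_distrib_left)
  finally have "vnorm (X *\<^sub>v v) \<le> singular_value X j * vnorm v"
    using singular_value_nonneg[OF X j] by (auto intro: power2_le_imp_le)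
  moreover have "v \<noteq> 0\<^sub>v n" "c * vnorm v \<le> vnorm (X *\<^sub>v v)"
    using exV[OF x x0] by (auto simp: v_def)
  moreover have "0 < vnorm v"
    using vnorm_eq_0_iff[OF v] \<open>v \<noteq> 0\<^sub>v n\<close> vnorm_nonneg[of v] by linarith
  ultimately show False
    using less mult_strict_right_mono[OF less, of "vnorm v"] by linarith
qed

section \<open>The expansion estimate\<close>

lemma psd_matD:
  assumes "psd_mat n A"
  shows "A \<in> carrier_mat n n" "mat_adjoint A = A"
    "\<And>v w. v \<in> carrier_vec n \<Longrightarrow> w \<in> carrier_vec n \<Longrightarrow> rip (A *\<^sub>v v) w = rip v (A *\<^sub>v w)"
    "\<And>v. v \<in> carrier_vec n \<Longrightarrow> 0 \<le> rip (A *\<^sub>v v) v"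
  using assms rip_hermitian[of A n] by (auto simp: psd_mat_def rip_def)

text \<open>The vector \<open>z\<close> is \<open>P y + Q U y\<close>, where \<open>Q\<close> is the square root of \<open>B\<close> and \<open>P Q = D U\<^sup>*\<close> is
  a polar decomposition, so that \<open>Q U = P\<^sup>-\<^sup>1 D\<close>.\<close>

lemma psd_sum_estimate:
  assumes P: "psd_mat n P" and D: "psd_mat n D" and B: "B \<in> carrier_mat n n"
    and R: "R \<in> carrier_mat n n" "P * R = 1\<^sub>m n" "R * P = 1\<^sub>m n"
    and DD: "D * D = P * B * P"
    and s: "0 < s" and g: "g \<in> carrier_vec n"
    and exp: "s\<^sup>2 * vnorm g \<le> vnorm (P *\<^sub>v (P *\<^sub>v (B *\<^sub>v g)))"
  defines "y \<equiv> P *\<^sub>v (B *\<^sub>v g)"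
  defines "z \<equiv> P *\<^sub>v y + R *\<^sub>v (D *\<^sub>v y)"
  shows "4 * s * (vnorm y)\<^sup>2 \<le> (vnorm z)\<^sup>2"
    and "2 * s * (vnorm z)\<^sup>2 \<le> rip (P *\<^sub>v (P *\<^sub>v z)) z + rip (B *\<^sub>v z) z"
proof -
  note Pc = psd_matD(1)[OF P] and Dc = psd_matD(1)[OF D]
  note Ph = psd_matD(3)[OF P] and Dh = psd_matD(3)[OF D] and Dpos = psd_matD(4)[OF D]
  have PR: "P *\<^sub>v (R *\<^sub>v v) = v" and RP: "R *\<^sub>v (P *\<^sub>v v) = v"
    and DDv: "D *\<^sub>v (D *\<^sub>v v) = P *\<^sub>v (B *\<^sub>v (P *\<^sub>v v))" if v: "v \<in> carrier_vec n" for v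
  proof -
    show "P *\<^sub>v (R *\<^sub>v v) = v" "R *\<^sub>v (P *\<^sub>v v) = v"
      using assoc_mult_mat_vec[OF Pc R(1) v] assoc_mult_mat_vec[OF R(1) Pc v] v by (simp_all add: R)
    show "D *\<^sub>v (D *\<^sub>v v) = P *\<^sub>v (B *\<^sub>v (P *\<^sub>v v))"
      using assoc_mult_mat_vec[OF Dc Dc v] Pc B v by (simp add: DD assoc_mult_mat_vec[of _ n n _ n])
  qed
  have Pcv[simp]: "P *\<^sub>v v \<in> carrier_vec n" and Dcv[simp]: "D *\<^sub>v v \<in> carrier_vec n"
    and Rcv[simp]: "R *\<^sub>v v \<in> carrier_vec n" and Bcv[simp]: "B *\<^sub>v v \<in> carrier_vec n"
    if "v \<in> carrier_vec n" for v
    using that Pc Dc R B by auto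
  note add_l = rip_add_left[of _ n] and add_r = rip_add_right[of _ n]
  \<comment> \<open>As \<open>R\<close> inverts \<open>P\<close>, \<open>f\<close> is P^{-1} g and
    \<open>u\<close> is P^{-1} z. Then D^2 f = P B g = y, so D f serves as D^{-1} y even when
    \<open>D\<close> is singular.\<close>
  define f where "f = R *\<^sub>v g"
  define r where "r = R *\<^sub>v (D *\<^sub>v y)"
  define u where "u = y + R *\<^sub>v r"
  have y[simp]: "y \<in> carrier_vec n" and f[simp]: "f \<in> carrier_vec n" using g by (simp_all add: y_def f_def)
  have r[simp]: "r \<in> carrier_vec n" by (simp add: r_def)
  have u[simp]: "u \<in> carrier_vec n" by (simp add: u_def)
  have z_eq: "z = P *\<^sub>v y + r" by (simp add: z_def r_def)
  have z[simp]: "z \<in> carrier_vec n" by (simp add: z_eq)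
  have Pf: "P *\<^sub>v f = g" using g by (simp add: f_def PR)
  have DDf: "D *\<^sub>v (D *\<^sub>v f) = y" by (simp add: DDv Pf y_def)
  have Pr: "P *\<^sub>v r = D *\<^sub>v y" by (simp add: r_def PR)
  have Pu: "P *\<^sub>v u = z"
    using mult_add_distrib_mat_vec[OF Pc, of y "R *\<^sub>v r"] by (simp add: u_def PR z_eq)
  have Py_r: "rip (P *\<^sub>v y) r = rip (D *\<^sub>v y) y"
    using Ph[of y r] rip_commute[of y n "D *\<^sub>v y"] by (simp add: Pr)
  have z_sq: "(vnorm z)\<^sup>2 = (vnorm (P *\<^sub>v y))\<^sup>2 + (vnorm r)\<^sup>2 + 2 * rip (D *\<^sub>v y) y"
    using rip_commute[of r n "P *\<^sub>v y"] Py_r by (simp add: rip_self[symmetric] z_eq add_l add_r)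
  \<comment> \<open>The inequality D + s^2 D^{-1} \<ge> 2 s as a quadratic form at \<open>y\<close>.
    It comes from positivity of \<open>D\<close> at s k - y with D k = y; each of the two cross
    terms equals s |y|^2.\<close>
  have lower: "2 * s * (vnorm y)\<^sup>2 \<le> s\<^sup>2 * rip (D *\<^sub>v f) y + rip (D *\<^sub>v y) y"
  proof -
    define k where "k = D *\<^sub>v f"
    have k[simp]: "k \<in> carrier_vec n" by (simp add: k_def)
    have Dk: "D *\<^sub>v k = y" by (simp add: k_def DDf)
    let ?h = "complex_of_real s \<cdot>\<^sub>v k + complex_of_real (-1) \<cdot>\<^sub>v y"
    have "D *\<^sub>v ?h = complex_of_real s \<cdot>\<^sub>v y + complex_of_real (-1) \<cdot>\<^sub>v (D *\<^sub>v y)"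
      using mult_add_distrib_mat_vec[OF Dc, of "complex_of_real s \<cdot>\<^sub>v k" "complex_of_real (-1) \<cdot>\<^sub>v y"]
      by (simp only: smult_carrier_vec k y mult_mat_vec[OF Dc] Dk)
    then have "0 \<le> rip (complex_of_real s \<cdot>\<^sub>v y + complex_of_real (-1) \<cdot>\<^sub>v (D *\<^sub>v y)) ?h"
      using Dpos[of ?h] by simp
    also have "\<dots> = s * (s * rip y k) - s * rip y y - s * rip (D *\<^sub>v y) k + rip (D *\<^sub>v y) y"
      by (simp add: add_l add_r rip_smult_left[of _ n] rip_smult_right[of _ n] algebra_simps
          del: of_real_minus of_real_1)
    finally show ?thesis
      using Dh[of y k] rip_commute[of y n k]
      by (simp add: Dk k_def[symmetric] rip_self power2_eq_square algebra_simps)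
  qed
  \<comment> \<open>Moving \<open>D\<close> and then \<open>P\<close> across the product turns <D f,
    y> into <g, r>. Cauchy-Schwarz, the assumption |P y| \<ge> s^2 |g| and the AM-GM inequality then
    bound twice this term by the first two summands of \<open>z_sq\<close>.\<close>
  have "s\<^sup>2 * rip (D *\<^sub>v f) y = s\<^sup>2 * rip g r"
    using Dh[of f y] Ph[of f r] by (simp add: Pr Pf)
  also have "\<dots> \<le> s\<^sup>2 * (vnorm g * vnorm r)"
    using rip_le_vnorm[OF g r] by (intro mult_left_mono) auto
  also have "\<dots> \<le> vnorm (P *\<^sub>v y) * vnorm r"
    using mult_right_mono[OF exp, of "vnorm r"] by (simp add: y_def algebra_simps)
  also have "2 * \<dots> \<le> (vnorm (P *\<^sub>v y))\<^sup>2 + (vnorm r)\<^sup>2"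
    using sum_squares_bound[of "vnorm (P *\<^sub>v y)" "vnorm r"] by simp
  finally have "2 * (s\<^sup>2 * rip (D *\<^sub>v f) y) \<le> (vnorm (P *\<^sub>v y))\<^sup>2 + (vnorm r)\<^sup>2" by simp
  then show z_ge: "4 * s * (vnorm y)\<^sup>2 \<le> (vnorm z)\<^sup>2"
    using lower by (simp add: z_sq)

  \<comment> \<open>The squared norms of \<open>a\<close> and \<open>b\<close> are the quadratic
    forms of P^2 and \<open>B\<close> at \<open>z\<close>, because z = P u and D^2 = P B P. The next
    computations give <a + b, y> = |z|^2.\<close>
  define a where "a = P *\<^sub>v z"
  define b where "b = D *\<^sub>v u"
  have a[simp]: "a \<in> carrier_vec n" and b[simp]: "b \<in> carrier_vec n" by (simp_all add: a_def b_def)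
  have "rip a y = rip z (P *\<^sub>v y)" unfolding a_def by (rule Ph) auto
  also have "\<dots> = (vnorm (P *\<^sub>v y))\<^sup>2 + rip (D *\<^sub>v y) y"
    using rip_commute[of r n "P *\<^sub>v y"] Py_r by (simp add: z_eq add_l rip_self)
  finally have ay: "rip a y = (vnorm (P *\<^sub>v y))\<^sup>2 + rip (D *\<^sub>v y) y" .
  have "rip b y = rip u (P *\<^sub>v r)" unfolding b_def Pr by (rule Dh) auto
  also have "\<dots> = rip z r" using Ph[of u r] by (simp add: Pu)
  also have "\<dots> = rip (D *\<^sub>v y) y + (vnorm r)\<^sup>2" by (simp add: z_eq add_l rip_self Py_r)
  finally have "(vnorm z)\<^sup>2 = rip (a + b) y" using ay by (simp add: z_sq add_l)
  also have "\<dots> \<le> vnorm (a + b) * vnorm y" by (rule rip_le_vnorm[of _ n]) auto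
  finally have zab: "(vnorm z)\<^sup>2 \<le> vnorm (a + b) * vnorm y" .
  \<comment> \<open>Square \<open>zab\<close>, bound |y|^2 by |z|^2 / (4 s), and cancel
    |z|^2.\<close>
  have ab: "4 * s * (vnorm z)\<^sup>2 \<le> (vnorm (a + b))\<^sup>2"
  proof (cases "vnorm z = 0")
    case False
    then have pos: "0 < (vnorm z)\<^sup>2" by simp
    have "4 * s * ((vnorm z)\<^sup>2)\<^sup>2 \<le> 4 * s * (vnorm (a + b) * vnorm y)\<^sup>2"
      using zab s by (intro mult_left_mono power_mono) auto
    also have "\<dots> = (vnorm (a + b))\<^sup>2 * (4 * s * (vnorm y)\<^sup>2)"
      by (simp add: power_mult_distrib)
    also have "\<dots> \<le> (vnorm (a + b))\<^sup>2 * (vnorm z)\<^sup>2"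
      using z_ge by (intro mult_left_mono) auto
    finally have "(4 * s * (vnorm z)\<^sup>2) * (vnorm z)\<^sup>2 \<le> (vnorm (a + b))\<^sup>2 * (vnorm z)\<^sup>2"
      by (simp add: power2_eq_square algebra_simps)
    then show ?thesis using pos by (rule mult_right_le_imp_le)
  qed simp
  have "(vnorm (a + b))\<^sup>2 \<le> (vnorm a + vnorm b)\<^sup>2"
    by (intro power_mono vnorm_triangle[of _ n]) auto
  also have "\<dots> \<le> 2 * ((vnorm a)\<^sup>2 + (vnorm b)\<^sup>2)"
    using sum_squares_bound[of "vnorm a" "vnorm b"] by (simp add: power2_sum)
  finally have ab2: "(vnorm (a + b))\<^sup>2 \<le> 2 * ((vnorm a)\<^sup>2 + (vnorm b)\<^sup>2)" .
  have "rip (P *\<^sub>v (P *\<^sub>v z)) z = (vnorm a)\<^sup>2"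
    using Ph[of "P *\<^sub>v z" z] by (simp add: a_def rip_self)
  moreover have "rip (B *\<^sub>v z) z = (vnorm b)\<^sup>2"
    using Ph[of "B *\<^sub>v (P *\<^sub>v u)" u] Dh[of "D *\<^sub>v u" u]
    by (simp add: Pu[symmetric] DDv[symmetric] b_def rip_self)
  ultimately show "2 * s * (vnorm z)\<^sup>2 \<le> rip (P *\<^sub>v (P *\<^sub>v z)) z + rip (B *\<^sub>v z) z"
    using ab ab2 by simp
qed

section \<open>From single vectors to a subspace\<close>

lemma psd_congruence:
  assumes P: "psd_mat n P" and B: "psd_mat n B"
  shows "psd_mat n (P * B * P)"
proof -
  note Pc = psd_matD(1)[OF P] and Bc = psd_matD(1)[OF B]
  have "mat_adjoint (P * B * P) = P * B * P"
    using mat_adjoint_mult[of "P * B" n n P n] mat_adjoint_mult[of P n n B n] Pc Bc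
      mult_carrier_mat[OF Pc Bc] psd_matD(2)[OF P] psd_matD(2)[OF B]
    by (simp add: assoc_mult_mat[of _ n n _ n _ n])
  moreover have "0 \<le> rip ((P * B * P) *\<^sub>v v) v" if v: "v \<in> carrier_vec n" for v
    using psd_matD(3)[OF P, of "B *\<^sub>v (P *\<^sub>v v)" v] psd_matD(4)[OF B, of "P *\<^sub>v v"] Pc Bc v
    by (simp add: assoc_mult_mat_vec[of _ n n _ n])
  ultimately show ?thesis using Pc Bc by (auto simp: psd_mat_def rip_def)
qed

lemma inverse_mat_exists:
  fixes A :: "'a :: field mat"
  assumes A: "A \<in> carrier_mat n n" and "det A \<noteq> 0"
  obtains R where "R \<in> carrier_mat n n" "A * R = 1\<^sub>m n" "R * A = 1\<^sub>m n"
  using det_non_zero_imp_unit[OF assms, of "()"] by (auto simp: Units_def ring_mat_def)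

text \<open>In \<open>psd_sum_estimate\<close> the vector \<open>z\<close> depends linearly on
  \<open>g\<close>, so the range of \<open>V\<close> is carried to the range of one matrix
  \<open>Z\<close>. The estimate is used with s = sqrt c, and \<open>P\<close> is invertible because
  \<open>det A\<close> is the square of \<open>det P\<close>.\<close>

lemma psd_sum_expands:
  assumes A: "psd_mat n A" and inv: "det A \<noteq> 0" and B: "psd_mat n B"
    and c: "0 < c" and ex: "expands_subspace n j (A * B) c"
  obtains Z where "Z \<in> carrier_mat n j"
    "\<And>x. x \<in> carrier_vec j \<Longrightarrow> x \<noteq> 0\<^sub>v j \<Longrightarrow> Z *\<^sub>v x \<noteq> 0\<^sub>v n"
    "\<And>x. x \<in> carrier_vec j \<Longrightarrow> x \<noteq> 0\<^sub>v j \<Longrightarrow> 2 * sqrt c * (vnorm (Z *\<^sub>v x))\<^sup>2 \<le>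
      rip (A *\<^sub>v (Z *\<^sub>v x) + B *\<^sub>v (Z *\<^sub>v x)) (Z *\<^sub>v x)"
proof -
  note Ac = psd_matD(1)[OF A] and Bc = psd_matD(1)[OF B]
  obtain P where P: "psd_mat n P" and PP: "P * P = A" using psd_sqrt[OF A] .
  note Pc = psd_matD(1)[OF P]
  obtain D where D: "psd_mat n D" and DD: "D * D = P * B * P"
    using psd_sqrt[OF psd_congruence[OF P B]] .
  note Dc = psd_matD(1)[OF D]
  have "det P \<noteq> 0" using inv det_mult[OF Pc Pc] by (auto simp: PP)
  from inverse_mat_exists[OF Pc this] obtain R
    where R: "R \<in> carrier_mat n n" "P * R = 1\<^sub>m n" "R * P = 1\<^sub>m n" .
  obtain V where V: "V \<in> carrier_mat n j" and exV: "\<And>x. x \<in> carrier_vec j \<Longrightarrow> x \<noteq> 0\<^sub>v j \<Longrightarrow>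
     V *\<^sub>v x \<noteq> 0\<^sub>v n \<and> c * vnorm (V *\<^sub>v x) \<le> vnorm ((A * B) *\<^sub>v (V *\<^sub>v x))"
    using ex by (auto simp: expands_subspace_def)
  define Y where "Y = P * (B * V)"
  have Y: "Y \<in> carrier_mat n j" using Pc Bc V by (simp add: Y_def)
  define Z where "Z = P * Y + R * (D * Y)"
  have Z: "Z \<in> carrier_mat n j" using Pc R Dc Y by (simp add: Z_def)
  have Av: "A *\<^sub>v v = P *\<^sub>v (P *\<^sub>v v)" if "v \<in> carrier_vec n" for v
    using that Pc by (simp add: PP[symmetric])
  have main: "Z *\<^sub>v x \<noteq> 0\<^sub>v n \<and> 2 * sqrt c * (vnorm (Z *\<^sub>v x))\<^sup>2 \<le>
      rip (A *\<^sub>v (Z *\<^sub>v x) + B *\<^sub>v (Z *\<^sub>v x)) (Z *\<^sub>v x)"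
    if x: "x \<in> carrier_vec j" and x0: "x \<noteq> 0\<^sub>v j" for x
  proof -
    define g where "g = V *\<^sub>v x"
    have g: "g \<in> carrier_vec n" using V x by (simp add: g_def)
    have g0: "g \<noteq> 0\<^sub>v n" using exV[OF x x0] by (simp add: g_def)
    define y where "y = P *\<^sub>v (B *\<^sub>v g)"
    have Bg: "B *\<^sub>v g \<in> carrier_vec n" using Bc g by simp
    have y: "y \<in> carrier_vec n" using Pc Bg by (simp add: y_def)
    have ABg: "(A * B) *\<^sub>v g = P *\<^sub>v (P *\<^sub>v (B *\<^sub>v g))"
      using Ac Bc g Av[OF Bg] by (simp add: assoc_mult_mat_vec[of _ n n _ n])
    have Yx: "Y *\<^sub>v x = y"
      using Pc Bc V x by (simp add: Y_def y_def g_def assoc_mult_mat_vec[of _ n n _ j]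
          mult_carrier_mat[of _ n n _ j])
    have Zx: "Z *\<^sub>v x = P *\<^sub>v y + R *\<^sub>v (D *\<^sub>v y)"
      using Pc R Dc Y x
      by (simp add: Z_def add_mult_distrib_mat_vec[of _ n j] assoc_mult_mat_vec[of _ n n _ j]
          mult_carrier_mat[of _ n n _ j] Yx)
    have exp: "(sqrt c)\<^sup>2 * vnorm g \<le> vnorm (P *\<^sub>v (P *\<^sub>v (B *\<^sub>v g)))"
      using exV[OF x x0] c by (simp add: g_def[symmetric] ABg[symmetric])
    note est = psd_sum_estimate[OF P D Bc R DD _ g exp, folded y_def, folded Zx]
    have Zxc: "Z *\<^sub>v x \<in> carrier_vec n" using Z x by simp
    \<comment> \<open>Injectivity of \<open>Z\<close>: the expansion bound makes P y = A B g
      nonzero, hence \<open>y\<close> is nonzero, and the first estimate passes this on to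
      \<open>Z *\<^sub>v x\<close>.\<close>
    have "0 < vnorm g" using vnorm_eq_0_iff[OF g] g0 vnorm_nonneg[of g] by linarith
    then have "0 < (sqrt c)\<^sup>2 * vnorm g" using c by simp
    then have "0 < vnorm (P *\<^sub>v y)" using exp unfolding y_def by linarith
    then have "vnorm y \<noteq> 0"
      using vnorm_eq_0_iff[OF y] Pc vnorm_eq_0_iff[of "P *\<^sub>v 0\<^sub>v n" n] by auto
    then have "0 < 4 * sqrt c * (vnorm y)\<^sup>2" using c by simp
    also have "\<dots> \<le> (vnorm (Z *\<^sub>v x))\<^sup>2" using est(1) c by simp
    finally have "Z *\<^sub>v x \<noteq> 0\<^sub>v n" using vnorm_eq_0_iff[OF Zxc] by auto
    moreover have "2 * sqrt c * (vnorm (Z *\<^sub>v x))\<^sup>2 \<le>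
      rip (A *\<^sub>v (Z *\<^sub>v x) + B *\<^sub>v (Z *\<^sub>v x)) (Z *\<^sub>v x)"
      using est(2) c Zxc Pc Bc rip_add_left[of "P *\<^sub>v (P *\<^sub>v (Z *\<^sub>v x))" n "B *\<^sub>v (Z *\<^sub>v x)" "Z *\<^sub>v x"]
      by (simp add: Av)
    ultimately show ?thesis ..
  qed
  show thesis using that[OF Z] main by blast
qed

section \<open>The quadratic expression in \<open>A\<close> and \<open>B\<close>\<close>

lemma smult_mat_mult_vec:
  fixes A :: "complex mat"
  assumes "A \<in> carrier_mat m n" "v \<in> carrier_vec n"
  shows "(k \<cdot>\<^sub>m A) *\<^sub>v v = k \<cdot>\<^sub>v (A *\<^sub>v v)"
  using assms by (intro eq_vecI) auto

lemma quadratic_mat_mult_vec: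
  fixes A B :: "complex mat"
  assumes A: "A \<in> carrier_mat n n" and B: "B \<in> carrier_mat n n" and v: "v \<in> carrier_vec n"
  shows "(A ^\<^sub>m 2 + k \<cdot>\<^sub>m (A * B) + B ^\<^sub>m 2) *\<^sub>v v =
    A *\<^sub>v (A *\<^sub>v v) + k \<cdot>\<^sub>v (A *\<^sub>v (B *\<^sub>v v)) + B *\<^sub>v (B *\<^sub>v v)"
proof -
  have sq: "M ^\<^sub>m 2 = M * M" if "M \<in> carrier_mat n n" for M :: "complex mat"
    using that by (simp add: numeral_2_eq_2)
  have AA: "A * A \<in> carrier_mat n n" and AB: "k \<cdot>\<^sub>m (A * B) \<in> carrier_mat n n"
    and BB: "B * B \<in> carrier_mat n n" using A B by auto
  show ?thesis
    unfolding sq[OF A] sq[OF B] add_mult_distrib_mat_vec[OF add_carrier_mat[OF AB] BB v]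
      add_mult_distrib_mat_vec[OF AA AB v] smult_mat_mult_vec[OF mult_carrier_mat[OF A B] v]
    using A B v by simp
qed

text \<open>Cauchy-Schwarz acts twice on the range of \<open>Z\<close>: it turns the bound on the
  form of A + B into |p + q| \<ge> 2 sqrt c |z| for p = A z and q = B z, and finally turns a lower
  bound on the form of the quadratic expression into one on the norm of its image.\<close>

lemma expands_quadratic:
  assumes A: "psd_mat n A" and inv: "det A \<noteq> 0" and B: "psd_mat n B"
    and c: "0 < c" and ex: "expands_subspace n j (A * B) c" and t: "-2 < t" "t \<le> 2"
  shows "expands_subspace n j (A ^\<^sub>m 2 + complex_of_real t \<cdot>\<^sub>m (A * B) + B ^\<^sub>m 2) ((2 + t) * c)"
    (is "expands_subspace n j ?X _")
proof -
  note Ac = psd_matD(1)[OF A] and Bc = psd_matD(1)[OF B]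
  obtain Z where Z: "Z \<in> carrier_mat n j"
    and Z0: "\<And>x. x \<in> carrier_vec j \<Longrightarrow> x \<noteq> 0\<^sub>v j \<Longrightarrow> Z *\<^sub>v x \<noteq> 0\<^sub>v n"
    and Zx: "\<And>x. x \<in> carrier_vec j \<Longrightarrow> x \<noteq> 0\<^sub>v j \<Longrightarrow> 2 * sqrt c * (vnorm (Z *\<^sub>v x))\<^sup>2 \<le>
      rip (A *\<^sub>v (Z *\<^sub>v x) + B *\<^sub>v (Z *\<^sub>v x)) (Z *\<^sub>v x)"
    by (rule psd_sum_expands[OF A inv B c ex], rule that)
  show ?thesis
    unfolding expands_subspace_def
  proof (intro bexI[OF _ Z] ballI impI conjI)
    fix x :: "complex vec" assume x: "x \<in> carrier_vec j" and x0: "x \<noteq> 0\<^sub>v j"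
    show "Z *\<^sub>v x \<noteq> 0\<^sub>v n" using x x0 by (rule Z0)
    define z where "z = Z *\<^sub>v x"
    have z[simp]: "z \<in> carrier_vec n" using Z x by (simp add: z_def)
    have z_pos: "0 < vnorm z"
      using vnorm_eq_0_iff[OF z] Z0[OF x x0] vnorm_nonneg[of z] by (auto simp: z_def less_le)
    define p where "p = A *\<^sub>v z"
    define q where "q = B *\<^sub>v z"
    have p[simp]: "p \<in> carrier_vec n" and q[simp]: "q \<in> carrier_vec n"
      using Ac Bc by (simp_all add: p_def q_def)
    have "(2 * sqrt c * vnorm z) * vnorm z \<le> vnorm (p + q) * vnorm z"
      using Zx[OF x x0] rip_le_vnorm[of "p + q" n z]
      by (simp add: z_def[symmetric] p_def[symmetric] q_def[symmetric] power2_eq_square mult.assoc)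
    then have "2 * sqrt c * vnorm z \<le> vnorm (p + q)"
      using z_pos by (rule mult_right_le_imp_le)
    then have "(2 * sqrt c * vnorm z)\<^sup>2 \<le> (vnorm (p + q))\<^sup>2"
      using c by (intro power_mono) auto
    then have "4 * c * (vnorm z)\<^sup>2 \<le> rip (p + q) (p + q)"
      using c by (simp add: power_mult_distrib rip_self)
    also have pq: "rip (p + q) (p + q) = rip p p + 2 * rip p q + rip q q"
      using rip_commute[of p n q] by (simp add: rip_add_left[of _ n] rip_add_right[of _ n])
    finally have sum: "4 * c * (vnorm z)\<^sup>2 \<le> rip p p + 2 * rip p q + rip q q" .
    let ?m = "p + complex_of_real (-1) \<cdot>\<^sub>v q"
    have "0 \<le> rip ?m ?m" by (simp add: rip_self)
    also have "\<dots> = rip p p - 2 * rip p q + rip q q"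
      using rip_commute[of p n q]
      by (simp add: rip_add_left[of _ n] rip_add_right[of _ n] rip_smult_left[of _ n]
          rip_smult_right[of _ n] del: of_real_minus of_real_1)
    finally have diff: "0 \<le> rip p p - 2 * rip p q + rip q q" .
    have "?X *\<^sub>v z = A *\<^sub>v p + complex_of_real t \<cdot>\<^sub>v (A *\<^sub>v q) + B *\<^sub>v q"
      unfolding p_def q_def by (rule quadratic_mat_mult_vec[OF Ac Bc z])
    then have "rip (?X *\<^sub>v z) z = rip (A *\<^sub>v p) z + t * rip (A *\<^sub>v q) z + rip (B *\<^sub>v q) z"
      using Ac Bc by (simp add: rip_add_left[of _ n] rip_smult_left[of _ n])
    also have "\<dots> = rip p p + t * rip p q + rip q q"
      using psd_matD(3)[OF A, of p z] psd_matD(3)[OF A, of q z] psd_matD(3)[OF B, of q z]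
        rip_commute[of p n q] by (simp add: p_def[symmetric] q_def[symmetric])
    also have "\<dots> = (2 + t) / 4 * (rip p p + 2 * rip p q + rip q q) +
        (2 - t) / 4 * (rip p p - 2 * rip p q + rip q q)"
      by (simp add: field_simps)
    also have "\<dots> \<ge> (2 + t) / 4 * (4 * c * (vnorm z)\<^sup>2)"
    proof -
      have "(2 + t) / 4 * (4 * c * (vnorm z)\<^sup>2) \<le> (2 + t) / 4 * (rip p p + 2 * rip p q + rip q q)"
        using sum t by (intro mult_left_mono) auto
      moreover have "0 \<le> (2 - t) / 4 * (rip p p - 2 * rip p q + rip q q)"
        using diff t by (intro mult_nonneg_nonneg) auto
      ultimately show ?thesis by linarith
    qed
    finally have "(2 + t) * c * vnorm z * vnorm z \<le> rip (?X *\<^sub>v z) z"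
      by (simp add: power2_eq_square algebra_simps)
    also have "\<dots> \<le> vnorm (?X *\<^sub>v z) * vnorm z"
      using Ac Bc by (intro rip_le_vnorm[of _ n] mult_mat_vec_carrier[of _ n n]) auto
    finally show "(2 + t) * c * vnorm (Z *\<^sub>v x) \<le> vnorm (?X *\<^sub>v (Z *\<^sub>v x))"
      using z_pos mult_right_le_imp_le unfolding z_def by blast
  qed
qed

section \<open>Perturbation and reduction to invertible \<open>A\<close>\<close>

lemma expands_subspace_perturb:
  assumes ex: "expands_subspace n j X c"
    and close: "\<And>v. v \<in> carrier_vec n \<Longrightarrow> vnorm (X *\<^sub>v v) \<le> vnorm (Y *\<^sub>v v) + d * vnorm v"
  shows "expands_subspace n j Y (c - d)"
proof -
  obtain V where V: "V \<in> carrier_mat n j" and exV: "\<And>x. x \<in> carrier_vec j \<Longrightarrow> x \<noteq> 0\<^sub>v j \<Longrightarrow>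
     V *\<^sub>v x \<noteq> 0\<^sub>v n \<and> c * vnorm (V *\<^sub>v x) \<le> vnorm (X *\<^sub>v (V *\<^sub>v x))"
    using ex by (auto simp: expands_subspace_def)
  \<comment> \<open>The same \<open>V\<close> works for \<open>Y\<close>; only the expansion
    constant drops, by \<open>d\<close>.\<close>
  have "(c - d) * vnorm (V *\<^sub>v x) \<le> vnorm (Y *\<^sub>v (V *\<^sub>v x))"
    if "x \<in> carrier_vec j" "x \<noteq> 0\<^sub>v j" for x
    using exV[OF that] close[of "V *\<^sub>v x"] V that by (simp add: left_diff_distrib)
  then show ?thesis using V exV by (auto simp: expands_subspace_def)
qed

text \<open>The shift adds e |v|^2 to the quadratic form, so no nonzero vector can lie in the
  kernel. This supplies invertible approximations of \<open>A\<close>.\<close>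

lemma psd_shift:
  assumes A: "psd_mat n A" and e: "0 < e"
  shows "psd_mat n (A + complex_of_real e \<cdot>\<^sub>m 1\<^sub>m n)" (is "psd_mat n ?A")
    and "det (A + complex_of_real e \<cdot>\<^sub>m 1\<^sub>m n) \<noteq> 0"
    and "\<And>v. v \<in> carrier_vec n \<Longrightarrow>
      (A + complex_of_real e \<cdot>\<^sub>m 1\<^sub>m n) *\<^sub>v v = A *\<^sub>v v + complex_of_real e \<cdot>\<^sub>v v"
proof -
  note Ac = psd_matD(1)[OF A]
  have Ac': "?A \<in> carrier_mat n n" using Ac by simp
  show shift: "?A *\<^sub>v v = A *\<^sub>v v + complex_of_real e \<cdot>\<^sub>v v" if "v \<in> carrier_vec n" for v
    using Ac that by (simp add: add_mult_distrib_mat_vec[of _ n n] smult_mat_mult_vec[of _ n n])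
  have quad: "rip (?A *\<^sub>v v) v = rip (A *\<^sub>v v) v + e * (vnorm v)\<^sup>2" if "v \<in> carrier_vec n" for v
    using Ac that by (simp add: shift rip_add_left[of _ n] rip_smult_left[of _ n] rip_self)
  have "mat_adjoint ?A = ?A"
  proof (rule eq_matI)
    fix i k assume "i < dim_row ?A" "k < dim_col ?A"
    then have ik: "i < n" "k < n" by auto
    have "cnj (A $$ (k, i)) = mat_adjoint A $$ (i, k)"
      using ik Ac by (subst mat_adjoint_index) auto
    then have "cnj (A $$ (k, i)) = A $$ (i, k)" by (simp add: psd_matD(2)[OF A])
    then show "mat_adjoint ?A $$ (i, k) = ?A $$ (i, k)"
      using ik Ac by (subst mat_adjoint_index) auto
  qed (use Ac in auto)
  then show "psd_mat n ?A"
    using Ac' quad psd_matD(4)[OF A] e by (auto simp: psd_mat_def rip_def[symmetric])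
  show "det ?A \<noteq> 0"
  proof
    assume "det ?A = 0"
    then obtain v where v: "v \<in> carrier_vec n" "v \<noteq> 0\<^sub>v n" "?A *\<^sub>v v = 0\<^sub>v n"
      using det_0_iff_vec_prod_zero_field[OF Ac'] by blast
    have "rip (0\<^sub>v n) v = 0" using v(1) by (simp add: rip_def)
    then have "rip (A *\<^sub>v v) v + e * (vnorm v)\<^sup>2 = 0" using quad[OF v(1)] v(3) by simp
    then have "e * (vnorm v)\<^sup>2 \<le> 0" using psd_matD(4)[OF A v(1)] by linarith
    then have "vnorm v = 0" using e by (simp add: mult_le_0_iff)
    then show False using v vnorm_eq_0_iff by blast
  qed
qed

theorem proposition4p2:
  fixes n :: nat and A B :: "complex mat"
  assumes "n \<ge> 1"
    and "psd_mat n A" and "psd_mat n B"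
  shows "\<forall>j \<in> {1..n}. \<forall>t::real. t \<in> {-2<..2} \<longrightarrow>
    (2 + t) * singular_value (A * B) j
      \<le> singular_value (A ^\<^sub>m 2 + complex_of_real t \<cdot>\<^sub>m (A * B) + B ^\<^sub>m 2) j"
proof (intro ballI allI impI)
  fix j and t :: real assume j: "j \<in> {1..n}" and "t \<in> {-2<..2}"
  then have t: "-2 < t" "t \<le> 2" by auto
  note A = assms(2) and B = assms(3)
  note Ac = psd_matD(1)[OF A] and Bc = psd_matD(1)[OF B]
  let ?X = "A ^\<^sub>m 2 + complex_of_real t \<cdot>\<^sub>m (A * B) + B ^\<^sub>m 2"
  have X: "?X \<in> carrier_mat n n" using Ac Bc by auto
  have AB: "A * B \<in> carrier_mat n n" using Ac Bc by auto
  let ?s = "singular_value (A * B) j"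
  obtain K where K: "0 \<le> K" and KA: "\<And>v. v \<in> carrier_vec n \<Longrightarrow> vnorm (A *\<^sub>v v) \<le> K * vnorm v"
    using mult_mat_vec_bounded[OF Ac] by metis
  obtain L where L: "0 \<le> L" and LB: "\<And>v. v \<in> carrier_vec n \<Longrightarrow> vnorm (B *\<^sub>v v) \<le> L * vnorm v"
    using mult_mat_vec_bounded[OF Bc] by metis
  \<comment> \<open>The loss e L comes from replacing A B by A' B with A' = A + e I, the loss e (2 K
    + 2 L + 1) from returning from the shifted quadratic expression to the original one.\<close>
  have approx: "(2 + t) * (?s - e * L) - e * (2 * K + 2 * L + 1) \<le> singular_value ?X j"
    if e: "0 < e" "e \<le> 1" for e
  \<comment> \<open>\<open>expands_quadratic\<close> needs a positive constant; otherwise the left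
    side is at most 0 and nonnegativity of singular values suffices.\<close>
  proof (cases "0 < ?s - e * L")
    case False
    then have "(2 + t) * (?s - e * L) \<le> 0" using t by (intro mult_nonneg_nonpos) auto
    moreover have "0 \<le> e * (2 * K + 2 * L + 1)" using e K L by simp
    ultimately show ?thesis using singular_value_nonneg[OF X j] by linarith
  next
    case True
    let ?e = "complex_of_real e"
    define A' where "A' = A + ?e \<cdot>\<^sub>m 1\<^sub>m n"
    note shift = psd_shift[OF A e(1), folded A'_def]
    note Ac' = psd_matD(1)[OF shift(1)]
    let ?X' = "A' ^\<^sub>m 2 + complex_of_real t \<cdot>\<^sub>m (A' * B) + B ^\<^sub>m 2"
    have "expands_subspace n j (A' * B) (?s - e * L)"
    proof (rule expands_subspace_perturb[OF expands_subspace_singular_value[OF AB j]])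
      fix v :: "complex vec" assume v: "v \<in> carrier_vec n"
      then have Bv: "B *\<^sub>v v \<in> carrier_vec n" using Bc by auto
      have "A *\<^sub>v (B *\<^sub>v v) = A' *\<^sub>v (B *\<^sub>v v) + complex_of_real (- e) \<cdot>\<^sub>v (B *\<^sub>v v)"
        unfolding shift(3)[OF Bv] using Ac Bc by (intro eq_vecI) auto
      then have "vnorm (A *\<^sub>v (B *\<^sub>v v)) \<le> vnorm (A' *\<^sub>v (B *\<^sub>v v)) + e * vnorm (B *\<^sub>v v)"
        using vnorm_triangle[of "A' *\<^sub>v (B *\<^sub>v v)" n "complex_of_real (- e) \<cdot>\<^sub>v (B *\<^sub>v v)"]
          vnorm_smult[of "- e" "B *\<^sub>v v"] Ac' Bv e by simp
      also have "\<dots> \<le> vnorm (A' *\<^sub>v (B *\<^sub>v v)) + e * (L * vnorm v)"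
        using LB[OF v] e by simp
      finally show "vnorm ((A * B) *\<^sub>v v) \<le> vnorm ((A' * B) *\<^sub>v v) + e * L * vnorm v"
        using Ac Ac' Bc v by simp
    qed
    from expands_quadratic[OF shift(1,2) B True this t]
    have "expands_subspace n j ?X' ((2 + t) * (?s - e * L))" .
    then have "expands_subspace n j ?X ((2 + t) * (?s - e * L) - e * (2 * K + 2 * L + 1))"
    proof (rule expands_subspace_perturb)
      fix v :: "complex vec" assume v: "v \<in> carrier_vec n"
      have Av: "A *\<^sub>v v \<in> carrier_vec n" and Bv: "B *\<^sub>v v \<in> carrier_vec n"
        and A'v: "A' *\<^sub>v v \<in> carrier_vec n"
        using Ac Bc Ac' v by auto
      have Xv: "?X *\<^sub>v v \<in> carrier_vec n" using X v by (rule mult_mat_vec_carrier)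
      let ?a = "complex_of_real (2 * e) \<cdot>\<^sub>v (A *\<^sub>v v)"
      let ?b = "complex_of_real (t * e) \<cdot>\<^sub>v (B *\<^sub>v v)"
      let ?c = "complex_of_real (e * e) \<cdot>\<^sub>v v"
      have A'A'v: "A' *\<^sub>v (A' *\<^sub>v v) = A *\<^sub>v (A *\<^sub>v v) + ?e \<cdot>\<^sub>v (A *\<^sub>v v) +
          (?e \<cdot>\<^sub>v (A *\<^sub>v v) + (?e * ?e) \<cdot>\<^sub>v v)"
        unfolding shift(3)[OF A'v] unfolding shift(3)[OF v]
        using mult_add_distrib_mat_vec[OF Ac Av, of "?e \<cdot>\<^sub>v v"] mult_mat_vec[OF Ac v] Av v
        by (simp add: smult_add_distrib_vec[of _ n] smult_smult_assoc)
      \<comment> \<open>The two quadratic expressions differ by 2 e A + t e B + e^2 I. Since |t|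
        \<le> 2 and e \<le> 1, the three error vectors have norms at most 2 e K, 2 e L and e times
        |v|.\<close>
      have "?X' *\<^sub>v v = ?X *\<^sub>v v + (?a + (?b + ?c))"
        unfolding quadratic_mat_mult_vec[OF Ac Bc v] quadratic_mat_mult_vec[OF Ac' Bc v]
          A'A'v shift(3)[OF Bv]
        using Ac Bc v by (intro eq_vecI) (auto simp: algebra_simps)
      moreover have "vnorm (?X *\<^sub>v v + (?a + (?b + ?c))) \<le> vnorm (?X *\<^sub>v v) + (vnorm ?a + (vnorm ?b + vnorm ?c))"
        using vnorm_triangle[OF Xv, of "?a + (?b + ?c)"] vnorm_triangle[of ?a n "?b + ?c"]
          vnorm_triangle[of ?b n ?c] Av Bv v by simp
      ultimately have "vnorm (?X' *\<^sub>v v) \<le> vnorm (?X *\<^sub>v v) + (vnorm ?a + (vnorm ?b + vnorm ?c))"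
        by simp
      also have "vnorm ?a \<le> e * (2 * K) * vnorm v"
        unfolding vnorm_smult using KA[OF v] e by simp
      also have "vnorm ?b \<le> e * (2 * L) * vnorm v"
      proof -
        have "\<bar>t * e\<bar> \<le> e * 2" using t e by (simp add: abs_mult)
        then have "\<bar>t * e\<bar> * vnorm (B *\<^sub>v v) \<le> e * 2 * (L * vnorm v)"
          using LB[OF v] e by (intro mult_mono) auto
        then show ?thesis unfolding vnorm_smult by (simp add: algebra_simps)
      qed
      also have "vnorm ?c \<le> e * vnorm v"
        unfolding vnorm_smult using e by (intro mult_right_mono) (auto simp: mult_le_cancel_left1)
      finally show "vnorm (?X' *\<^sub>v v) \<le> vnorm (?X *\<^sub>v v) + e * (2 * K + 2 * L + 1) * vnorm v"
        by (simp add: algebra_simps)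
    qed
    then show ?thesis by (rule expands_subspace_le_singular_value[OF X j])
  qed
  \<comment> \<open>Both losses vanish as e tends to 0 from the right, and the weak inequality
    survives the limit.\<close>
  have lim: "((\<lambda>e. (2 + t) * (?s - e * L) - e * (2 * K + 2 * L + 1)) \<longlongrightarrow>
      (2 + t) * (?s - 0 * L) - 0 * (2 * K + 2 * L + 1)) (at_right 0)"
    by (intro tendsto_intros)
  have "\<forall>\<^sub>F e in at_right 0. (2 + t) * (?s - e * L) - e * (2 * K + 2 * L + 1) \<le> singular_value ?X j"
    unfolding eventually_at_right_field using approx by (intro exI[of _ 1]) auto
  from tendsto_upperbound[OF lim this] show "(2 + t) * ?s \<le> singular_value ?X j" by simp
qed

end
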